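(* Let $r\ge 4$ be even, let $q$ be an odd prime power, let $\mathcal L$ be an $m$-cover of $\mathcal Q(r,q)$ and let $\bar{\mathcal L}$ be the set of points of $\mathcal H(r,q^2)$ lying on the extended lines of $\mathcal L$. Then $\bar{\mathcal L}$ is an $(m(q^2-q)+q+1)$-tight set of $\mathcal H(r,q^2)$ if and only if $\mathcal L$ is an $(r-2)$-dual cover of parabolic type $I$.
   Context: $\theta_{n,q}=q^n+\dots+q+1$ for $n\ge0$, $\theta_{-1,q}=0$; $\theta_{n,q^2}$ is the same expression with $q^2$ in place of $q$. $\mathcal Q(r,q)$ is the parabolic quadric (polar space) of $\Sigma=\mathrm{PG}(r,q)$, $q$ odd, $r\ge4$ even, given by a nondegenerate quadratic form on $\mathbb F_q^{r+1}$ with associated symmetric bilinear form $b$ and orthogonal polarity $\perp$. Lines of $\mathcal Q(r,q)$ are the lines of $\Sigma$ contained in the quadric. An $m$-cover of lines of $\mathcal Q(r,q)$ ($m>0$) is a set $\mathcal L$ of lines of $\mathcal Q(r,q)$ such that every point of $\mathcal Q(r,q)$ lies on exactly $m$ lines of $\mathcal L$. An $m$-cover $\mathcal L$ of $\mathcal Q(r,q)$ is $(r-2)$-dual of parabolic type $I$ if, for every line $\ell$ of $\Sigma$, the number of lines of $\mathcal L$ contained in $\ell^\perp$ equals $\frac{m\theta_{r-5,q}}{q+1}+q^{r-4}$ if $\ell\in\mathcal L$, and equals $\frac{m\theta_{r-5,q}}{q+1}$ if $\ell\notin\mathcal L$ and $|\ell\cap\mathcal Q(r,q)|\in\{0,2,q+1\}$.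 $\Sigma$ is embedded in $\mathrm{PG}(r,q^2)$ by extension of scalars; the extended line of a line $\ell$ of $\Sigma$ is the line of $\mathrm{PG}(r,q^2)$ containing the $q+1$ points of $\ell$. Let $\tau$ be the semilinear involution of $\mathrm{PG}(r,q^2)$ raising coordinates to the $q$-th power (fixing $\Sigma$ pointwise) and $B$ the $\mathbb F_{q^2}$-bilinear extension of $b$. $\mathcal H(r,q^2)$ is the non-degenerate Hermitian variety $\{\langle x\rangle:B(x,\tau(x))=0\}$, with unitary polarity $\langle x\rangle^{\perp_h}=\{y:B(y,\tau(x))=0\}$. A subset $\mathcal X$ of points of $\mathcal H(r,q^2)$ is $i$-tight if for every point $P$ of $\mathcal H(r,q^2)$, $|P^{\perp_h}\cap\mathcal X|$ equals $i\,\theta_{\frac{r-4}{2},q^2}+q^{r-2}$ if $P\in\mathcal X$ and $i\,\theta_{\frac{r-4}{2},q^2}$ if $P\notin\mathcal X$. *)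

theory Defs
  imports "HOL-Analysis.Analysis" "HOL-Number_Theory.Prime_Powers"
begin

text \<open>
  Throughout, \<open>'a\<close> is the field of order \<open>q\<close>, \<open>'b\<close> the field of order \<open>q\<^sup>2\<close>, and the index type
  \<open>'n\<close> has \<open>r + 1\<close> elements, so that the projective spaces over \<open>'a ^ 'n\<close> and \<open>'b ^ 'n\<close> are
  PG(r,q) and PG(r,q^2). A subspace of a projective space is identified with the underlying
  linear subspace, hence incidence is inclusion.
\<close>

definition points :: "('k::field ^ 'n::finite) set set" where
  "points = {P. vec.subspace P \<and> vec.dim P = 1}"

definition lines :: "('k::field ^ 'n::finite) set set" where
  "lines = {l. vec.subspace l \<and> vec.dim l = 2}"

text \<open>The index is an integer, so that \<open>theta (-1) q = 0\<close>.\<close>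

definition theta :: "int \<Rightarrow> nat \<Rightarrow> nat" where
  "theta n q = (\<Sum>i<nat (n + 1). q ^ i)"


section \<open>The parabolic quadric\<close>

definition polar_form :: "('k::field ^ 'n::finite \<Rightarrow> 'k) \<Rightarrow> 'k ^ 'n \<Rightarrow> 'k ^ 'n \<Rightarrow> 'k" where
  "polar_form Q x y = Q (x + y) - Q x - Q y"

text \<open>The polar form is symmetric, so linearity in one argument gives bilinearity.\<close>

definition quadratic_form :: "('k::field ^ 'n::finite \<Rightarrow> 'k) \<Rightarrow> bool" where
  "quadratic_form Q \<longleftrightarrow>
     (\<forall>c x. Q (c *s x) = c\<^sup>2 * Q x) \<and>
     (\<forall>x. Vector_Spaces.linear (*s) (*) (polar_form Q x))"

text \<open>Nondegeneracy via the polar form is the right notion in odd characteristic only.\<close>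

definition nondegenerate_quadratic_form :: "('k::field ^ 'n::finite \<Rightarrow> 'k) \<Rightarrow> bool" where
  "nondegenerate_quadratic_form Q \<longleftrightarrow>
     quadratic_form Q \<and> (\<forall>x. (\<forall>y. polar_form Q x y = 0) \<longrightarrow> x = 0)"

definition quadric_points :: "('k::field ^ 'n::finite \<Rightarrow> 'k) \<Rightarrow> ('k ^ 'n) set set" where
  "quadric_points Q = {P \<in> points. \<forall>x\<in>P. Q x = 0}"

definition quadric_lines :: "('k::field ^ 'n::finite \<Rightarrow> 'k) \<Rightarrow> ('k ^ 'n) set set" where
  "quadric_lines Q = {l \<in> lines. \<forall>x\<in>l. Q x = 0}"

definition perp :: "('k::field ^ 'n::finite \<Rightarrow> 'k) \<Rightarrow> ('k ^ 'n) set \<Rightarrow> ('k ^ 'n) set" where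
  "perp Q S = {y. \<forall>x\<in>S. polar_form Q x y = 0}"

definition line_cover ::
  "('k::field ^ 'n::finite \<Rightarrow> 'k) \<Rightarrow> nat \<Rightarrow> ('k ^ 'n) set set \<Rightarrow> bool" where
  "line_cover Q m L \<longleftrightarrow>
     m > 0 \<and> L \<subseteq> quadric_lines Q \<and>
     (\<forall>P\<in>quadric_points Q. card {l \<in> L. P \<subseteq> l} = m)"

definition dual_cover_parabolic_I ::
  "nat \<Rightarrow> nat \<Rightarrow> ('k::field ^ 'n::finite \<Rightarrow> 'k) \<Rightarrow> nat \<Rightarrow> ('k ^ 'n) set set \<Rightarrow> bool" where
  "dual_cover_parabolic_I r q Q m L \<longleftrightarrow>
     line_cover Q m L \<and>
     (\<forall>l\<in>lines.
        (l \<in> L \<longrightarrow>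
           real (card {k \<in> L. k \<subseteq> perp Q l}) =
             real m * real (theta (int r - 5) q) / (real q + 1) + real q ^ (r - 4)) \<and>
        (l \<notin> L \<and> card {P \<in> quadric_points Q. P \<subseteq> l} \<in> {0, 2, q + 1} \<longrightarrow>
           real (card {k \<in> L. k \<subseteq> perp Q l}) =
             real m * real (theta (int r - 5) q) / (real q + 1)))"


section \<open>Extension of scalars and the Hermitian variety\<close>

definition field_embedding :: "('a::field \<Rightarrow> 'b::field) \<Rightarrow> bool" where
  "field_embedding \<iota> \<longleftrightarrow>
     \<iota> 1 = 1 \<and> (\<forall>x y. \<iota> (x + y) = \<iota> x + \<iota> y) \<and> (\<forall>x y. \<iota> (x * y) = \<iota> x * \<iota> y)"

definition extend_vec :: "('a::field \<Rightarrow> 'b::field) \<Rightarrow> 'a ^ 'n::finite \<Rightarrow> 'b ^ 'n" where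
  "extend_vec \<iota> x = (\<chi> i. \<iota> (x $ i))"

definition extended_line ::
  "('a::field \<Rightarrow> 'b::field) \<Rightarrow> ('a ^ 'n::finite) set \<Rightarrow> ('b ^ 'n) set" where
  "extended_line \<iota> l = vec.span (extend_vec \<iota> ` l)"

definition frobenius_vec :: "nat \<Rightarrow> 'b::field ^ 'n::finite \<Rightarrow> 'b ^ 'n" where
  "frobenius_vec q x = (\<chi> i. (x $ i) ^ q)"

definition extended_polar_form ::
  "('a::field \<Rightarrow> 'b::field) \<Rightarrow> ('a ^ 'n::finite \<Rightarrow> 'a) \<Rightarrow> 'b ^ 'n \<Rightarrow> 'b ^ 'n \<Rightarrow> 'b" where
  "extended_polar_form \<iota> Q x y =
     (\<Sum>i\<in>UNIV. \<Sum>j\<in>UNIV. \<iota> (polar_form Q (axis i 1) (axis j 1)) * x $ i * y $ j)"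

definition hermitian_points ::
  "nat \<Rightarrow> ('a::field \<Rightarrow> 'b::field) \<Rightarrow> ('a ^ 'n::finite \<Rightarrow> 'a) \<Rightarrow> ('b ^ 'n) set set" where
  "hermitian_points q \<iota> Q =
     {P \<in> points. \<forall>x\<in>P. extended_polar_form \<iota> Q x (frobenius_vec q x) = 0}"

definition hermitian_perp ::
  "nat \<Rightarrow> ('a::field \<Rightarrow> 'b::field) \<Rightarrow> ('a ^ 'n::finite \<Rightarrow> 'a) \<Rightarrow> ('b ^ 'n) set \<Rightarrow> ('b ^ 'n) set" where
  "hermitian_perp q \<iota> Q P =
     {y. \<forall>x\<in>P. extended_polar_form \<iota> Q y (frobenius_vec q x) = 0}"

definition tight_set ::
  "nat \<Rightarrow> nat \<Rightarrow> ('a::field \<Rightarrow> 'b::field) \<Rightarrow> ('a ^ 'n::finite \<Rightarrow> 'a) \<Rightarrow> nat \<Rightarrow> ('b ^ 'n) set set \<Rightarrow> bool"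
  where
  "tight_set r q \<iota> Q i X \<longleftrightarrow>
     X \<subseteq> hermitian_points q \<iota> Q \<and>
     (\<forall>P\<in>hermitian_points q \<iota> Q.
        card {R \<in> X. R \<subseteq> hermitian_perp q \<iota> Q P} =
          i * theta ((int r - 4) div 2) (q\<^sup>2) + (if P \<in> X then q ^ (r - 2) else 0))"

definition cover_extension ::
  "nat \<Rightarrow> ('a::field \<Rightarrow> 'b::field) \<Rightarrow> ('a ^ 'n::finite \<Rightarrow> 'a) \<Rightarrow> ('a ^ 'n) set set \<Rightarrow> ('b ^ 'n) set set"
  where
  "cover_extension q \<iota> Q L =
     {P \<in> hermitian_points q \<iota> Q. \<exists>l\<in>L. P \<subseteq> extended_line \<iota> l}"

end

theory Submission
  imports Defs
begin

text \<open>
  Choose \<open>\<omega>\<close> in the large field with \<open>\<omega>\<^sup>q = - \<omega>\<close>; then \<open>\<omega>\<^sup>2 = \<alpha>\<close> is a nonsquare of the small field and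
  every vector is uniquely \<open>x + \<omega> y\<close> with \<open>x\<close>, \<open>y\<close> over the small field. It is isotropic for the
  Hermitian form iff \<open>Q x = \<alpha> Q y\<close>. If \<open>x\<close> and \<open>y\<close> span a line \<open>l\<close>, this can be achieved by a suitable
  basis of \<open>l\<close> exactly when \<open>l\<close> is nondegenerate or totally singular, that is when \<open>l\<close> has \<open>0\<close>, \<open>2\<close>
  or \<open>q + 1\<close> points on the quadric.

  For a Hermitian point \<open>P = \<langle>u + \<omega> v\<rangle>\<close> let \<open>N\<close> be the number of points of the quadric, and \<open>A\<close> the
  number of lines of the cover, in \<open>{u, v}\<^sup>\<bottom>\<close>. The perp of \<open>P\<close> contains an extended line of the cover
  or meets it in one point, according to whether the line lies in \<open>{u, v}\<^sup>\<bottom>\<close> or not. Double counting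
  therefore gives \<open>\<bar>L\<bar> + q\<^sup>2 A - (m - 1) N\<close> points of the extended cover in the perp of \<open>P\<close>. The number
  \<open>N\<close> depends only on \<open>r\<close> and on whether \<open>P\<close> is defined over the small field. If it is, a further count
  determines \<open>A\<close> and \<open>P\<close> always satisfies the tight set condition; if not, the condition at \<open>P\<close> is
  equivalent to the prescribed value of \<open>A\<close> for the line \<open>\<langle>u, v\<rangle>\<close>.
\<close>

section \<open>Finite fields\<close>

text \<open>Translation by 1 permutes the ring, so the sum of all elements does not change when 1 is
  added to each of them.\<close>

lemma of_nat_card_eq_0: "of_nat CARD('k) = (0 :: 'k::{ring_1,finite})"
proof -
  have "(\<Sum>x\<in>UNIV. x + 1) = (\<Sum>x\<in>UNIV. x :: 'k)"
    by (rule sum.reindex_bij_witness[of _ "\<lambda>x. x - 1" "\<lambda>x. x + 1"]) auto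
  then show ?thesis
    by (simp add: sum.distrib)
qed

lemma two_neq_0:
  assumes "odd CARD('k::{field,finite})"
  shows "(2 :: 'k) \<noteq> 0"
proof
  assume two: "(2 :: 'k) = 0"
  obtain n where "CARD('k) = 2 * n + 1"
    using assms by (rule oddE)
  then have "(of_nat CARD('k) :: 'k) = 2 * of_nat n + 1"
    by (metis of_nat_1 of_nat_add of_nat_mult of_nat_numeral)
  then show False
    using two by (simp add: of_nat_card_eq_0)
qed

text \<open>Multiplication by a nonzero \<open>x\<close> permutes the nonzero elements; comparing
  the two products gives exponent \<open>CARD('k) - 1\<close>.\<close>

lemma power_card_eq_self: "x ^ CARD('k) = (x :: 'k::{field,finite})"
proof (cases "x = 0")
  case False
  have "(\<Prod>y\<in>UNIV-{0}. x * y) = (\<Prod>y\<in>UNIV-{0}. y)"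
    by (rule prod.reindex_bij_witness[of _ "\<lambda>y. y / x" "\<lambda>y. x * y"]) (use False in auto)
  then have "x ^ (CARD('k) - 1) = 1"
    by (simp add: prod.distrib)
  then show ?thesis
    using power_minus_mult[of "CARD('k)" x] by (simp add: finite_UNIV_card_ge_0)
qed (simp add: finite_UNIV_card_ge_0)

text \<open>The field order is a power of \<open>q\<close>, so the characteristic is the prime below
  \<open>q\<close> and raising to the power \<open>q\<close> iterates the Frobenius map.\<close>

lemma power_primepow_add:
  fixes x y :: "'k::{field,finite}"
  assumes "primepow q" and "CARD('k) = q ^ n"
  shows "(x + y) ^ q = x ^ q + y ^ q"
proof -
  obtain p k where p: "prime p" and q: "q = p ^ k"
    using assms(1) by (auto simp: primepow_def)
  have prime: "prime CHAR('k)"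
    by (simp add: finite_imp_CHAR_pos prime_CHAR_semidom)
  have "CHAR('k) dvd p ^ (k * n)"
    using assms(2) of_nat_card_eq_0[where 'k='k]
    by (metis of_nat_eq_0_iff_char_dvd power_mult q)
  then have "CHAR('k) = p"
    using p prime prime_dvd_power primes_dvd_imp_eq by blast
  then show ?thesis
    using freshmans_dream'[OF prime] q by blast
qed

text \<open>Squaring is at most two-to-one, and the fibre over 0 is a singleton, which makes the
  inequality strict.\<close>

lemma card_squares:
  assumes "odd CARD('k::{field,finite})"
  shows "CARD('k) < 2 * card (range (\<lambda>x::'k. x\<^sup>2))"
proof -
  let ?S = "range (\<lambda>x::'k. x\<^sup>2)"
  have fib: "card {x::'k. x\<^sup>2 = y} \<le> 2" for y
  proof (cases "\<exists>x. x\<^sup>2 = y")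
    case True
    then obtain x where x: "x\<^sup>2 = y" by blast
    have "{x::'k. x\<^sup>2 = y} \<subseteq> {x, -x}"
      using x by (auto simp: power2_eq_iff)
    then have "card {x::'k. x\<^sup>2 = y} \<le> card {x, -x}"
      by (rule card_mono[rotated]) simp
    also have "\<dots> \<le> 2"
      by (simp add: card_insert_if)
    finally show ?thesis .
  next
    case False
    then have "{x::'k. x\<^sup>2 = y} = {}" by blast
    then show ?thesis by simp
  qed
  have "CARD('k) = card (\<Union>y\<in>?S. {x. x\<^sup>2 = y})"
    by (rule arg_cong[where f=card]) auto
  also have "\<dots> \<le> (\<Sum>y\<in>?S. card {x. x\<^sup>2 = y})"
    by (rule card_UN_le) simp
  also have "\<dots> = card {x::'k. x\<^sup>2 = 0} + (\<Sum>y\<in>?S-{0}. card {x. x\<^sup>2 = y})"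
    by (rule sum.remove) (auto intro: image_eqI[of _ _ 0])
  also have "\<dots> \<le> 1 + (\<Sum>y\<in>?S-{0}. 2)"
    by (intro add_mono sum_mono fib) simp
  also have "\<dots> = 1 + 2 * (card ?S - 1)"
    by (subst sum_constant, subst card_Diff_singleton) (auto intro: image_eqI[of _ _ 0])
  also have "\<dots> < 2 * card ?S"
    using card_gt_0_iff[of ?S] by (simp add: algebra_simps) 
  finally show ?thesis .
qed

text \<open>Pigeonhole: the values \<open>a * s\<^sup>2\<close> and the values
  \<open>c - b * t\<^sup>2\<close> each fill more than half of the field, so they have a common
  element.\<close>

lemma binary_form_universal:
  fixes a b c :: "'k::{field,finite}"
  assumes "odd CARD('k)" and "a \<noteq> 0" and "b \<noteq> 0"
  shows "\<exists>s t. a * s\<^sup>2 + b * t\<^sup>2 = c"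
proof -
  let ?S = "range (\<lambda>x::'k. x\<^sup>2)"
  have inj: "inj_on (\<lambda>x. a * x) ?S" "inj_on (\<lambda>x. c - b * x) ?S"
    using assms by (auto simp: inj_on_def)
  have "(\<lambda>x. a * x) ` ?S \<inter> (\<lambda>x. c - b * x) ` ?S \<noteq> {}"
  proof
    assume "(\<lambda>x. a * x) ` ?S \<inter> (\<lambda>x. c - b * x) ` ?S = {}"
    then have "card ((\<lambda>x. a * x) ` ?S \<union> (\<lambda>x. c - b * x) ` ?S) = 2 * card ?S"
      by (subst card_Un_disjoint) (simp_all only: card_image[OF inj(1)] card_image[OF inj(2)], auto)
    moreover have "card ((\<lambda>x. a * x) ` ?S \<union> (\<lambda>x. c - b * x) ` ?S) \<le> CARD('k)"
      by (rule card_mono) auto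
    ultimately show False
      using card_squares[OF assms(1)] by linarith
  qed
  then obtain s t where "a * s\<^sup>2 = c - b * t\<^sup>2" by blast
  then have "a * s\<^sup>2 + b * t\<^sup>2 = c" by simp
  then show ?thesis by blast
qed


section \<open>Points, lines and hyperplanes over a finite field\<close>

lemma span_pair: "vec.span {x, y} = {s *s x + t *s y | s t. True}"
  for x y :: "'k::field ^ 'n::finite"
proof -
  have "v = s *s x + t *s y \<longleftrightarrow> v - s *s x = t *s y" for v s t
    by (auto simp: algebra_simps)
  then show ?thesis
    by (auto simp: vec.span_insert vec.span_singleton)
qed

lemma points_iff: "P \<in> points \<longleftrightarrow> (\<exists>x. x \<noteq> 0 \<and> P = vec.span {x})"
  for P :: "('k::field ^ 'n::finite) set"
proof
  assume "P \<in> points"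
  then have P: "vec.subspace P" "vec.dim P = 1" by (auto simp: points_def)
  obtain B where B: "B \<subseteq> P" "vec.independent B" "P \<subseteq> vec.span B" "card B = 1"
    using vec.basis_exists[of P] P(2) by metis
  then obtain x where x: "B = {x}" by (auto simp: card_1_singleton_iff)
  have "P = vec.span {x}"
    using B P(1) x by (metis vec.span_subspace)
  moreover have "x \<noteq> 0" using B(2) x by (simp add: vec.dependent_single)
  ultimately show "\<exists>x. x \<noteq> 0 \<and> P = vec.span {x}" by blast
next
  assume "\<exists>x. x \<noteq> 0 \<and> P = vec.span {x}"
  then obtain x where "x \<noteq> 0" "P = vec.span {x}" by blast
  then show "P \<in> points"
    by (simp add: points_def vec.dim_eq_card_independent vec.dependent_single)
qed

text \<open>The clause \<open>x \<noteq> y\<close> guards against the collapse of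
  \<open>{x, y}\<close> to a singleton, which would be independent for nonzero
  \<open>x\<close>.\<close>

lemma pair_independent_iff:
  "x \<noteq> y \<and> vec.independent {x, y} \<longleftrightarrow> x \<noteq> 0 \<and> (\<forall>c. y \<noteq> c *s x)"
  for x y :: "'k::field ^ 'n::finite"
proof (cases "x = y")
  case True
  then have "y = 1 *s x" by simp
  then show ?thesis using True by blast
next
  case False
  have "vec.independent {y, x} \<longleftrightarrow> (if y \<in> {x} then vec.independent {x} else vec.independent {x} \<and> y \<notin> vec.span {x})"
    by (rule vec.independent_insert)
  with False show ?thesis
    by (auto simp: insert_commute vec.dependent_single vec.span_singleton)
qed

lemma lines_iff:
  "l \<in> lines \<longleftrightarrow> (\<exists>x y. x \<noteq> 0 \<and> (\<forall>c. y \<noteq> c *s x) \<and> l = vec.span {x, y})"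
  for l :: "('k::field ^ 'n::finite) set"
proof
  assume "l \<in> lines"
  then have l: "vec.subspace l" "vec.dim l = 2" by (auto simp: lines_def)
  obtain B where B: "B \<subseteq> l" "vec.independent B" "l \<subseteq> vec.span B" "card B = 2"
    using vec.basis_exists[of l] l(2) by metis
  then obtain x y where xy: "B = {x, y}" "x \<noteq> y" by (auto simp: card_2_iff)
  have "l = vec.span {x, y}"
    using B l(1) xy by (metis vec.span_subspace)
  then show "\<exists>x y. x \<noteq> 0 \<and> (\<forall>c. y \<noteq> c *s x) \<and> l = vec.span {x, y}"
    using B(2) xy pair_independent_iff[of x y] by blast
next
  assume "\<exists>x y. x \<noteq> 0 \<and> (\<forall>c. y \<noteq> c *s x) \<and> l = vec.span {x, y}"
  then obtain x y where "x \<noteq> 0 \<and> (\<forall>c. y \<noteq> c *s x)" "l = vec.span {x, y}" by blast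
  then show "l \<in> lines"
    using pair_independent_iff[of x y]
    by (simp add: lines_def vec.dim_eq_card_independent)
qed

section \<open>Cardinalities of points, lines and cones\<close>

lemma card_span_single:
  fixes x :: "'k::{field,finite} ^ 'n::finite"
  assumes "x \<noteq> 0"
  shows "card (vec.span {x}) = CARD('k)"
  unfolding vec.span_singleton using assms
  by (intro card_image) (auto simp: inj_on_def)

lemma card_line:
  fixes l :: "('k::{field,finite} ^ 'n::finite) set"
  assumes "l \<in> lines"
  shows "card l = CARD('k)\<^sup>2"
proof -
  obtain x y where xy: "x \<noteq> 0" "\<And>c. y \<noteq> c *s x" and l: "l = vec.span {x, y}"
    using assms unfolding lines_iff by blast
  have "inj (\<lambda>(s, t). s *s x + t *s y)"
  proof (rule injI, clarify)
    fix s t s' t'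
    assume eq: "s *s x + t *s y = s' *s x + t' *s y"
    then have *: "(t - t') *s y = (s' - s) *s x"
      by (simp add: algebra_simps)
    have "t = t'"
    proof (rule ccontr)
      assume "t \<noteq> t'"
      then have "y = ((s' - s) / (t - t')) *s x"
        using arg_cong[OF *, of "\<lambda>v. inverse (t - t') *s v"]
        by (simp add: divide_inverse mult.commute del: vector_sub_rdistrib vector_ssub_ldistrib)
      then show False using xy(2) by blast
    qed
    with * xy(1) show "s = s' \<and> t = t'" by simp
  qed
  moreover have "l = range (\<lambda>(s, t). s *s x + t *s y)"
    by (auto simp: l span_pair)
  ultimately have "card l = CARD('k \<times> 'k)"
    by (simp add: card_image)
  then show ?thesis
    by (simp add: power2_eq_square)
qed

lemma line_basis:
  fixes l :: "('k::field ^ 'n::finite) set"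
  assumes "l \<in> lines" and "x \<in> l" and "y \<in> l" and "x \<noteq> 0" and "\<And>c. y \<noteq> c *s x"
  shows "l = vec.span {x, y}"
proof -
  have "{x, y} \<subseteq> l" "vec.independent {x, y}" "card {x, y} = vec.dim l" "vec.subspace l"
    using assms pair_independent_iff[of x y] by (auto simp: lines_def)
  then show ?thesis
    by (metis vec.card_ge_dim_independent order_refl vec.span_subspace)
qed

text \<open>The points inside \<open>S\<close> partition its nonzero vectors into classes of size
  \<open>CARD('k) - 1\<close>. Working with cones covers both subspaces and the singular vectors of
  a subspace.\<close>

lemma card_points_cone:
  fixes S :: "('k::{field,finite} ^ 'n::finite) set"
  assumes "0 \<in> S" and "\<And>c x. x \<in> S \<Longrightarrow> c *s x \<in> S"
  shows "card {P \<in> points. P \<subseteq> S} * (CARD('k) - 1) = card S - 1"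
proof -
  let ?C = "(\<lambda>P. P - {0}) ` {P \<in> points. P \<subseteq> S}"
  have sub: "vec.span {x} \<subseteq> S" if "x \<in> S" for x
    using assms(2)[OF that] by (auto simp: vec.span_singleton)
  have span_eq: "vec.span {y} = vec.span {x}" if "y \<in> vec.span {x}" "y \<noteq> 0" for x y :: "'k ^ 'n"
    using that by (auto simp: vec.span_singleton image_iff) (metis vector_smult_assoc divide_inverse
      field_class.field_inverse mult.assoc mult.right_neutral vector_smult_lzero nonzero_eq_divide_eq)
  have "(CARD('k) - 1) * card ?C = card (\<Union>?C)"
  proof (rule card_partition)
    show "\<And>c. c \<in> ?C \<Longrightarrow> card c = CARD('k) - 1"
      by (auto simp: points_iff card_span_single vec.span_zero)
    fix c1 c2
    assume c: "c1 \<in> ?C" "c2 \<in> ?C" "c1 \<noteq> c2"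
    then obtain x y where "c1 = vec.span {x} - {0}" "c2 = vec.span {y} - {0}"
      by (auto simp: points_iff)
    with c(3) span_eq show "c1 \<inter> c2 = {}" by blast
  qed auto
  moreover have "\<Union>?C = S - {0}"
    using sub by (auto simp: points_iff intro: vec.span_base)
  moreover have "card ?C = card {P \<in> points. P \<subseteq> S}"
    by (rule card_image, rule inj_onI) (metis (no_types, lifting) insert_Diff mem_Collect_eq points_iff vec.span_zero)
  ultimately show ?thesis
    using assms(1) by (simp add: mult.commute)
qed

lemma card_field_ge_2: "CARD('k::{field,finite}) \<ge> 2"
  using card_mono[of UNIV "{0, 1 :: 'k}"] by simp

lemma card_points_subspace:
  fixes W :: "('k::{field,finite} ^ 'n::finite) set"
  assumes "vec.subspace W"
  shows "card W = CARD('k) \<Longrightarrow> card {P \<in> points. P \<subseteq> W} = 1"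
    and "card W = CARD('k)\<^sup>2 \<Longrightarrow> card {P \<in> points. P \<subseteq> W} = CARD('k) + 1"
proof -
  \<comment> \<open>Writing the order as \<open>n + 2\<close> removes truncated subtraction and
    makes the factor \<open>n + 1\<close> visibly nonzero, hence cancellable.\<close>
  obtain n where n: "CARD('k) = n + 2"
    using card_field_ge_2[where 'k='k] by (metis le_add_diff_inverse2)
  have *: "card {P \<in> points. P \<subseteq> W} * (n + 1) = card W - 1"
    using card_points_cone[of W] assms n by (simp add: vec.subspace_0 vec.subspace_scale)
  show "card {P \<in> points. P \<subseteq> W} = 1" if "card W = CARD('k)"
  proof -
    have "card {P \<in> points. P \<subseteq> W} * (n + 1) = 1 * (n + 1)"
      unfolding * that n by simp
    then show ?thesis by (metis mult_cancel2 add_eq_0_iff_both_eq_0 one_neq_zero)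
  qed
  show "card {P \<in> points. P \<subseteq> W} = CARD('k) + 1" if "card W = CARD('k)\<^sup>2"
  proof -
    have "card {P \<in> points. P \<subseteq> W} * (n + 1) = (CARD('k) + 1) * (n + 1)"
      unfolding * that n by (simp add: power2_eq_square algebra_simps)
    then show ?thesis by (metis mult_cancel2 add_eq_0_iff_both_eq_0 one_neq_zero)
  qed
qed

section \<open>Linear functionals and their kernels\<close>

lemma functional_simps:
  assumes "Vector_Spaces.linear (*s) (*) (f :: 'k::field ^ 'n::finite \<Rightarrow> 'k)"
  shows "f (x + y) = f x + f y" and "f (c *s x) = c * f x" and "f (x - y) = f x - f y" and "f 0 = 0"
proof -
  have *: "f (x + y) = f x + f y" "f (c *s x) = c * f x" for x y c
    using assms by (auto simp: Vector_Spaces.linear_iff)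
  show "f (x + y) = f x + f y" "f (c *s x) = c * f x" by (fact *)+
  show "f (x - y) = f x - f y" using *(1)[of "x - y" y] by simp
  show "f 0 = 0" using *(1)[of 0 0] by (metis add.right_neutral add_cancel_left_right)
qed

text \<open>Each vector of \<open>W\<close> is uniquely a kernel vector plus a multiple of
  \<open>w\<close>. The lemma serves over the small and over the large field.\<close>

lemma card_kernel:
  fixes f :: "'k::{field,finite} ^ 'n::finite \<Rightarrow> 'k"
  assumes W: "vec.subspace W" and f: "Vector_Spaces.linear (*s) (*) f"
    and w: "w \<in> W" "f w \<noteq> 0"
  shows "CARD('k) * card {v \<in> W. f v = 0} = card W"
proof -
  note fs = functional_simps[OF f]
  have "bij_betw (\<lambda>(c, v). v + c *s w) (UNIV \<times> {v \<in> W. f v = 0}) W"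
  proof (rule bij_betw_byWitness[where f' = "\<lambda>v. (f v / f w, v - (f v / f w) *s w)"])
    show "\<forall>z\<in>UNIV \<times> {v \<in> W. f v = 0}. (case case z of (c, v) \<Rightarrow> v + c *s w of
        v \<Rightarrow> (f v / f w, v - (f v / f w) *s w)) = z"
      using w by (auto simp: fs)
    show "\<forall>v\<in>W. (case (f v / f w, v - (f v / f w) *s w) of (c, v) \<Rightarrow> v + c *s w) = v"
      by simp
    show "(\<lambda>(c, v). v + c *s w) ` (UNIV \<times> {v \<in> W. f v = 0}) \<subseteq> W"
      using W w by (auto intro: vec.subspace_add vec.subspace_scale)
    show "(\<lambda>v. (f v / f w, v - (f v / f w) *s w)) ` W \<subseteq> UNIV \<times> {v \<in> W. f v = 0}"
      using W w by (auto simp: fs intro: vec.subspace_diff vec.subspace_scale)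
  qed
  then show ?thesis
    by (auto dest!: bij_betw_same_card simp: card_cartesian_product)
qed

text \<open>Subtracting \<open>(f v / f w) *s w\<close> moves \<open>v\<close> into the kernel of
  \<open>f\<close>, so \<open>g\<close> is determined by its value at \<open>w\<close>. All
  computations of double perps and of radicals of hyperplane sections rest on this.\<close>

lemma linear_multiple_of_kernel_subset:
  fixes f g :: "'k::field ^ 'n::finite \<Rightarrow> 'k"
  assumes W: "vec.subspace W" and f: "Vector_Spaces.linear (*s) (*) f"
    and g: "Vector_Spaces.linear (*s) (*) g"
    and ker: "\<And>v. v \<in> W \<Longrightarrow> f v = 0 \<Longrightarrow> g v = 0"
  shows "\<exists>c. \<forall>v\<in>W. g v = c * f v"
proof (cases "\<forall>v\<in>W. f v = 0")
  case True
  with ker show ?thesis by auto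
next
  case False
  then obtain w where w: "w \<in> W" "f w \<noteq> 0" by blast
  note fs = functional_simps[OF f] and gs = functional_simps[OF g]
  have "g v = (g w / f w) * f v" if "v \<in> W" for v
  proof -
    have "v - (f v / f w) *s w \<in> W" using W w(1) that by (simp add: vec.subspace_diff vec.subspace_scale)
    then have "g (v - (f v / f w) *s w) = 0" using ker w(2) by (simp add: fs)
    then show ?thesis using w(2) by (simp add: gs field_simps)
  qed
  then show ?thesis by blast
qed

section \<open>Counting singular vectors\<close>

locale odd_quadratic_space =
  fixes Q :: "'a::{field,finite} ^ 'n::finite \<Rightarrow> 'a"
  assumes nondegenerate: "nondegenerate_quadratic_form Q"
    and odd_card: "odd CARD('a)"
begin

abbreviation B where "B \<equiv> polar_form Q"

lemma two_nz [simp]: "(2 :: 'a) \<noteq> 0"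
  by (rule two_neq_0[OF odd_card])

lemma four_nz [simp]: "(4 :: 'a) \<noteq> 0"
proof -
  have "(4 :: 'a) = 2 * 2" by simp
  then show ?thesis using two_nz by (metis mult_eq_0_iff)
qed

lemma Q_scale: "Q (c *s x) = c\<^sup>2 * Q x"
  using nondegenerate by (simp add: nondegenerate_quadratic_form_def quadratic_form_def)

lemma Q_0 [simp]: "Q 0 = 0"
  using Q_scale[of 0 0] by simp

lemma Q_add: "Q (x + y) = Q x + Q y + B x y"
  by (simp add: polar_form_def)

lemma B_sym: "B x y = B y x"
  by (simp add: polar_form_def add.commute)

lemma B_linear: "Vector_Spaces.linear (*s) (*) (B x)"
  using nondegenerate by (simp add: nondegenerate_quadratic_form_def quadratic_form_def)

lemmas B_right = functional_simps[OF B_linear]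

lemma B_left: "B (x + y) z = B x z + B y z" "B (c *s x) z = c * B x z"
  "B (x - y) z = B x z - B y z" "B 0 z = 0"
  by (simp_all only: B_sym[of _ z] B_right)

lemma B_self: "B x x = 2 * Q x"
proof -
  have "x + x = 2 *s x" by (simp add: vec_eq_iff)
  then have "Q (x + x) = 2\<^sup>2 * Q x" by (simp add: Q_scale)
  then show ?thesis by (simp add: polar_form_def)
qed

lemma B_nondegenerate: "(\<And>y. B x y = 0) \<Longrightarrow> x = 0"
  using nondegenerate by (simp add: nondegenerate_quadratic_form_def)

lemma Q_combination: "Q (s *s x + t *s y) = s\<^sup>2 * Q x + t\<^sup>2 * Q y + s * t * B x y"
  by (simp add: Q_add Q_scale B_left B_right)

lemma perp_subspace: "vec.subspace (perp Q S)"
  by (auto simp: perp_def vec.subspace_def B_right)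

lemma perp_span: "perp Q (vec.span S) = perp Q S"
proof -
  have "B x y = 0" if "x \<in> vec.span S" "y \<in> perp Q S" for x y
  proof -
    have "vec.subspace {x. B x y = 0}"
      by (auto simp: vec.subspace_def B_left)
    moreover have "S \<subseteq> {x. B x y = 0}"
      using that(2) by (auto simp: perp_def)
    ultimately show ?thesis
      using that(1) vec.span_minimal by blast
  qed
  then show ?thesis
    by (auto simp: perp_def intro: vec.span_base)
qed

section \<open>Radicals of subspaces and their hyperplane sections\<close>

definition radical :: "('a ^ 'n) set \<Rightarrow> ('a ^ 'n) set" where
  "radical W = W \<inter> perp Q W"

lemma radical_iff: "x \<in> radical W \<longleftrightarrow> x \<in> W \<and> (\<forall>y\<in>W. B x y = 0)"
  using B_sym[of x] by (simp add: radical_def perp_def)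

text \<open>A vector of the radical is orthogonal to itself, and \<open>B x x = 2 * Q x\<close> with
  2 invertible.\<close>

lemma Q_radical: "x \<in> radical W \<Longrightarrow> Q x = 0"
  using B_self[of x] by (auto simp: radical_def perp_def)

lemma subspace_radical: "vec.subspace W \<Longrightarrow> vec.subspace (radical W)"
  unfolding radical_def by (intro vec.subspace_inter perp_subspace)

lemma subspace_inter_perp: "vec.subspace W \<Longrightarrow> vec.subspace (W \<inter> perp Q S)"
  by (intro vec.subspace_inter perp_subspace)

lemma inter_perp_single: "W \<inter> perp Q {x} = {v \<in> W. B x v = 0}"
  by (auto simp: perp_def)

lemma card_inter_perp:
  assumes "vec.subspace W" and "y \<in> W" and "B x y \<noteq> 0"
  shows "CARD('a) * card (W \<inter> perp Q {x}) = card W"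
  unfolding inter_perp_single using card_kernel[OF assms(1) B_linear assms(2,3)] .

lemma card_inter_perp_le:
  assumes "vec.subspace W"
  shows "card W \<le> CARD('a) * card (W \<inter> perp Q {x})"
proof (cases "\<exists>y\<in>W. B x y \<noteq> 0")
  case True
  then show ?thesis using card_inter_perp[OF assms] by fastforce
next
  case False
  then have "W \<inter> perp Q {x} = W" by (auto simp: perp_def)
  then show ?thesis by simp
qed

text \<open>Three mutually orthogonal nonsingular vectors already span a singular one.\<close>

lemma singular_outside_radical:
  assumes W: "vec.subspace W" and card: "card W = CARD('a) ^ (2 * k + 3) * card (radical W)"
  shows "\<exists>x\<in>W. Q x = 0 \<and> x \<notin> radical W"
proof (rule ccontr)
  let ?q = "CARD('a)" and ?R = "radical W"
  assume "\<not> (\<exists>x\<in>W. Q x = 0 \<and> x \<notin> ?R)"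
  then have anis: "Q x \<noteq> 0" if "x \<in> W" "x \<notin> ?R" for x using that by blast
  have q: "?q \<ge> 2"
    using card_field_ge_2[where 'k='a] by simp
  have R0: "card ?R > 0"
    using vec.subspace_0[OF subspace_radical[OF W]] by (auto simp: card_gt_0_iff)
  have ex: "\<exists>x. x \<in> X \<and> x \<notin> ?R" if "card X > card ?R" for X :: "('a ^ 'n) set"
    using that card_mono[of ?R X] by fastforce
  \<comment> \<open>Each perp costs at most a factor \<open>?q\<close>. With a factor of at least
    \<open>?q ^ 3\<close> available, vectors outside the radical remain after two perps, which
    supplies \<open>a\<close>, \<open>b\<close> and \<open>c\<close> in turn.\<close>
  have "?q ^ 1 < ?q ^ (2 * k + 3)" "?q ^ 2 < ?q ^ (2 * k + 3)" "?q ^ 0 < ?q ^ (2 * k + 3)"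
    using q by (intro power_strict_increasing; simp)+
  then have qs: "card ?R < card W" "?q * card ?R < card W" "?q * (?q * card ?R) < card W"
    using R0 by (simp_all add: card power2_eq_square flip: mult.assoc)
  obtain a where a: "a \<in> W" "a \<notin> ?R" using ex[OF qs(1)] by blast
  define W1 where "W1 = W \<inter> perp Q {a}"
  have W1: "vec.subspace W1" "card W \<le> ?q * card W1"
    unfolding W1_def using W by (simp_all add: subspace_inter_perp card_inter_perp_le)
  then have "?q * card ?R < ?q * card W1" using qs(2) by linarith
  then obtain b where b: "b \<in> W1" "b \<notin> ?R" using ex[of W1] by auto
  define W2 where "W2 = W1 \<inter> perp Q {b}"
  have "card W1 \<le> ?q * card W2"
    unfolding W2_def using W1 by (simp add: card_inter_perp_le)
  then have "?q * card W1 \<le> ?q * (?q * card W2)" by simp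
  then have "?q * (?q * card ?R) < ?q * (?q * card W2)" using qs(3) W1(2) by linarith
  then obtain c where c: "c \<in> W2" "c \<notin> ?R" using ex[of W2] by auto
  have inW: "b \<in> W" "c \<in> W" and orth: "B a b = 0" "B a c = 0" "B b c = 0"
    using b c by (auto simp: W1_def W2_def perp_def)
  \<comment> \<open>The form on the span of \<open>a\<close> and \<open>b\<close> represents
    \<open>- Q c\<close>; adding \<open>c\<close> to such a vector gives a singular vector that is
    not orthogonal to \<open>c\<close>.\<close>
  obtain s t where st: "Q a * s\<^sup>2 + Q b * t\<^sup>2 = - Q c"
    using binary_form_universal[OF odd_card] anis[OF a] anis[OF inW(1) b(2)] by blast
  define v where "v = c + (s *s a + t *s b)"
  have "Q v = 0"
    using st by (simp add: v_def Q_add Q_scale B_left B_right orth B_sym[of c] algebra_simps)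
  moreover have "v \<in> W"
    using W a(1) inW by (simp add: v_def vec.subspace_add vec.subspace_scale)
  moreover have "B v c \<noteq> 0"
    using anis[OF inW(2) c(2)] by (simp add: v_def B_left orth B_self)
  then have "v \<notin> ?R"
    using inW(2) by (auto simp: radical_def perp_def B_sym[of _ v])
  ultimately show False using anis by blast
qed

text \<open>The new radical is the direct sum of the old one and the span of \<open>x\<close>: if
  \<open>v\<close> is orthogonal to the hyperplane section, then \<open>B v\<close> is a multiple of
  \<open>B x\<close> on \<open>W\<close>, and subtracting that multiple of \<open>x\<close> lands in
  the old radical.\<close>

lemma radical_inter_perp:
  assumes W: "vec.subspace W" and x: "x \<in> W" "Q x = 0" "x \<notin> radical W"
  shows "card (radical (W \<inter> perp Q {x})) = CARD('a) * card (radical W)"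
proof -
  let ?W' = "W \<inter> perp Q {x}"
  obtain y where y: "y \<in> W" "B x y \<noteq> 0"
    using x(1,3) by (auto simp: radical_def perp_def B_sym)
  have xx: "B x x = 0" using x(2) by (simp add: B_self)
  have inj: "inj_on (\<lambda>(c, w). w + c *s x) (UNIV \<times> radical W)"
  proof (rule inj_onI, clarify)
    fix c c' w w'
    assume w: "w \<in> radical W" "w' \<in> radical W" and eq: "w + c *s x = w' + c' *s x"
    have "B (w + c *s x) y = B (w' + c' *s x) y" using eq by simp
    moreover have "B w y = 0" "B w' y = 0"
      using w y(1) by (auto simp: radical_def perp_def B_sym[of _ y])
    ultimately have "c = c'" using y(2) by (simp add: B_left)
    with eq show "c = c' \<and> w = w'" by simp
  qed
  have "(\<lambda>(c, w). w + c *s x) ` (UNIV \<times> radical W) = radical ?W'" (is "?L = _")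
  proof (intro set_eqI iffI)
    fix v assume "v \<in> ?L"
    then obtain c w where v: "v = w + c *s x" and w: "w \<in> radical W" by auto
    have "B x w = 0"
      using w x(1) B_sym[of x w] by (simp add: radical_iff)
    then show "v \<in> radical ?W'"
      using W w x(1) xx
      by (simp add: v radical_iff inter_perp_single B_right B_left vec.subspace_add vec.subspace_scale)
  next
    fix v assume v: "v \<in> radical ?W'"
    then have "B v u = 0" if "u \<in> W" "B x u = 0" for u
      using that by (simp add: radical_iff inter_perp_single)
    then obtain c where c: "\<And>u. u \<in> W \<Longrightarrow> B v u = c * B x u"
      using linear_multiple_of_kernel_subset[OF W B_linear B_linear] by blast
    have "v \<in> W" using v by (simp add: radical_iff)
    then have "v - c *s x \<in> radical W"
      using W x(1) c by (simp add: radical_iff B_left vec.subspace_diff vec.subspace_scale)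
    moreover have "v = (v - c *s x) + c *s x" by simp
    ultimately show "v \<in> ?L" by (auto intro!: image_eqI[of _ _ "(c, v - c *s x)"])
  qed
  then have "card (radical ?W') = card ((UNIV :: 'a set) \<times> radical W)"
    using card_image[OF inj] by simp
  then show ?thesis by (simp add: card_cartesian_product)
qed

text \<open>
  Take a singular \<open>x\<close> in \<open>W\<close> outside the radical. For \<open>B x v \<noteq> 0\<close> exactly one of the vectors \<open>v + t x\<close> is
  singular, and \<open>W \<inter> x\<^sup>\<bottom>\<close> has one dimension less than \<open>W\<close> but a radical of one dimension more.
\<close>

lemma card_singular:
  assumes "vec.subspace W" and "card W = CARD('a) ^ (2 * k + 1) * card (radical W)"
  shows "CARD('a) * card {v \<in> W. Q v = 0} = card W"
  using assms
proof (induction k arbitrary: W)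
  case (0 W)
  show ?case
  proof (cases "\<exists>x\<in>W. Q x = 0 \<and> x \<notin> radical W")
    case False
    then have "{v \<in> W. Q v = 0} = radical W"
      using Q_radical by (auto simp: radical_def)
    then show ?thesis using 0 by simp
  next
    case True
    then obtain x where x: "x \<in> W" "Q x = 0" "x \<notin> radical W" by blast
    obtain y where y: "y \<in> W" "B x y \<noteq> 0"
      using x(1,3) by (auto simp: radical_def perp_def B_sym)
    \<comment> \<open>This case is contradictory: the enlarged radical would force
      \<open>card W\<close> to be at least \<open>CARD('a)\<close> squared times
      \<open>card (radical W)\<close>, whereas for \<open>k = 0\<close> the factor is
      \<open>CARD('a)\<close>.\<close>
    have "card (radical (W \<inter> perp Q {x})) \<le> card (W \<inter> perp Q {x})"
      by (rule card_mono) (auto simp: radical_def)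
    then have "CARD('a) * (CARD('a) * card (radical W)) \<le> card W"
      using radical_inter_perp[OF 0(1) x] card_inter_perp[OF 0(1) y]
      by (metis mult_le_mono2)
    moreover have "card (radical W) > 0"
      using vec.subspace_0[OF subspace_radical[OF 0(1)]] by (auto simp: card_gt_0_iff)
    moreover have "CARD('a) \<ge> 2"
      using card_field_ge_2[where 'k='a] by simp
    ultimately show ?thesis using 0(2) by simp
  qed
next
  case (Suc k W)
  let ?q = "CARD('a)"
  obtain x where x: "x \<in> W" "Q x = 0" "x \<notin> radical W"
    using singular_outside_radical[OF Suc.prems(1), of k] Suc.prems(2) by (auto simp: numeral_3_eq_3)
  let ?W' = "W \<inter> perp Q {x}"
  obtain y where y: "y \<in> W" "B x y \<noteq> 0"
    using x(1,3) by (auto simp: radical_def perp_def B_sym)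
  have W': "vec.subspace ?W'" "?q * card ?W' = card W"
    using Suc.prems(1) y by (simp_all add: subspace_inter_perp card_inter_perp)
  have "?q * card ?W' = ?q * (?q ^ (2 * k + 1) * card (radical ?W'))"
    using W'(2) Suc.prems(2) radical_inter_perp[OF Suc.prems(1) x] by simp
  then have IH: "?q * card {v \<in> ?W'. Q v = 0} = card ?W'"
    using Suc.IH[OF W'(1)] by simp
  have xx: "B x x = 0" using x(2) by (simp add: B_self)
  have "bij_betw (\<lambda>(t, v). v + t *s x) (UNIV \<times> {v \<in> W. B x v \<noteq> 0 \<and> Q v = 0}) {v \<in> W. B x v \<noteq> 0}"
    (is "bij_betw ?f ?A ?C")
  proof (rule bij_betw_byWitness[where f' = "\<lambda>v. (Q v / B x v, v - (Q v / B x v) *s x)"])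
    have Q': "Q (v + t *s x) = Q v + t * B x v" for v t
      using x(2) by (simp add: Q_add Q_scale B_right B_sym[of v])
    have Q'': "Q (v - t *s x) = Q v - t * B x v" for v t
      using Q'[of v "- t"] by simp
    show "\<forall>z\<in>?A. (case ?f z of v \<Rightarrow> (Q v / B x v, v - (Q v / B x v) *s x)) = z"
      by (auto simp: Q' B_right xx)
    show "\<forall>v\<in>?C. ?f (Q v / B x v, v - (Q v / B x v) *s x) = v" by simp
    show "?f ` ?A \<subseteq> ?C"
      using Suc.prems(1) x(1) by (auto simp: B_right xx intro: vec.subspace_add vec.subspace_scale)
    show "(\<lambda>v. (Q v / B x v, v - (Q v / B x v) *s x)) ` ?C \<subseteq> ?A"
      using Suc.prems(1) x(1)
      by (auto simp: B_right xx Q'' intro: vec.subspace_diff vec.subspace_scale)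
  qed
  then have off: "?q * card {v \<in> W. B x v \<noteq> 0 \<and> Q v = 0} = card {v \<in> W. B x v \<noteq> 0}"
    by (auto dest!: bij_betw_same_card simp: card_cartesian_product)
  have split: "card {v \<in> W. P v} = card {v \<in> ?W'. P v} + card {v \<in> W. B x v \<noteq> 0 \<and> P v}" for P
    by (subst card_Un_disjoint[symmetric]) (auto simp: perp_def intro!: arg_cong[where f=card])
  show ?case
    using IH off split[of "\<lambda>v. True"] split[of "\<lambda>v. Q v = 0"]
    by (simp add: distrib_left Int_def)
qed

section \<open>Singular points in perps\<close>

lemma quadric_points_within:
  "{P \<in> quadric_points Q. P \<subseteq> W} = {P \<in> points. P \<subseteq> {v \<in> W. Q v = 0}}"
  by (auto simp: quadric_points_def)

text \<open>Modulo its radical, \<open>W\<close> has the odd dimension \<open>2 * k + 1\<close>,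
  where hyperbolic and elliptic types do not arise. The count is the number of points of a
  hyperplane of \<open>W\<close>, whatever \<open>e\<close> is.\<close>

lemma card_quadric_points_within:
  assumes "vec.subspace W" and "card W = CARD('a) ^ Suc d"
    and "card (radical W) = CARD('a) ^ e" and "d = e + 2 * k"
  shows "card {P \<in> quadric_points Q. P \<subseteq> W} * (CARD('a) - 1) = CARD('a) ^ d - 1"
proof -
  have "card W = CARD('a) ^ (2 * k + 1) * card (radical W)"
    unfolding assms(2-4) by (simp flip: power_add) (simp add: add_ac)
  then have "CARD('a) * card {v \<in> W. Q v = 0} = CARD('a) * CARD('a) ^ d"
    using card_singular[OF assms(1), of k] by (simp add: assms(2))
  then have "card {v \<in> W. Q v = 0} = CARD('a) ^ d"
    by (metis mult_cancel1 zero_less_card_finite less_numeral_extra(3))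
  then show ?thesis
    unfolding quadric_points_within using assms(1)
    by (subst card_points_cone) (auto simp: vec.subspace_0 vec.subspace_scale Q_scale)
qed

lemma radical_UNIV: "radical UNIV = {0}"
  using B_nondegenerate by (auto simp: radical_iff B_left)

lemma card_quadric_points:
  assumes "CARD('n) = r + 1" and "even r"
  shows "card (quadric_points Q) * (CARD('a) - 1) = CARD('a) ^ r - 1"
proof -
  from assms(2) obtain k where "r = 0 + 2 * k" by (metis add_0 dvdE)
  then show ?thesis
    using card_quadric_points_within[of UNIV r 0 k] assms(1) by (simp add: radical_UNIV)
qed

lemma card_perp_single:
  assumes "x \<noteq> 0"
  shows "CARD('a) * card (perp Q {x}) = CARD('a) ^ CARD('n)"
proof -
  obtain y where "B x y \<noteq> 0" using B_nondegenerate assms by blast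
  then show ?thesis using card_inter_perp[of UNIV y x] by simp
qed

text \<open>\<open>B w\<close> vanishes on the kernel of \<open>B x\<close>, hence is a multiple of
  it, and nondegeneracy turns this into a relation between the vectors.\<close>

lemma perp_perp_single:
  assumes "w \<in> perp Q (perp Q {x})"
  shows "w \<in> vec.span {x}"
proof -
  have "B w v = 0" if "B x v = 0" for v
    using assms that B_sym[of w] by (simp add: perp_def)
  then obtain c where c: "\<And>v. B w v = c * B x v"
    using linear_multiple_of_kernel_subset[OF vec.subspace_UNIV B_linear B_linear] by blast
  then have "w - c *s x = 0"
    by (intro B_nondegenerate) (simp add: B_left)
  then show ?thesis by (auto simp: vec.span_singleton)
qed

text \<open>Inside \<open>perp Q {x}\<close> the functional of \<open>w\<close> is a multiple of
  that of \<open>y\<close>; subtracting this multiple of \<open>y\<close> from \<open>w\<close>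
  reduces the claim to a single vector.\<close>

lemma perp_perp_pair:
  assumes "w \<in> perp Q (perp Q {x, y})"
  shows "w \<in> vec.span {x, y}"
proof -
  have "B w v = 0" if "v \<in> perp Q {x}" "B y v = 0" for v
    using assms that B_sym[of w] by (simp add: perp_def)
  then obtain c where c: "\<And>v. v \<in> perp Q {x} \<Longrightarrow> B w v = c * B y v"
    using linear_multiple_of_kernel_subset[OF perp_subspace B_linear B_linear] by blast
  have "B v (w - c *s y) = 0" if "v \<in> perp Q {x}" for v
    using c[OF that] B_sym[of v] by (simp add: B_left)
  then have "w - c *s y \<in> vec.span {x}"
    by (intro perp_perp_single) (simp add: perp_def)
  then show ?thesis
    by (subst insert_commute) (auto simp: vec.span_breakdown_eq[of w y "{x}"])
qed

text \<open>The perp has vector dimension \<open>r\<close> and its radical is the point itself, so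
  the quotient has the odd dimension \<open>r - 1\<close>.\<close>

lemma card_quadric_points_perp_point:
  assumes "CARD('n) = r + 1" and "even r" and "r \<ge> 2" and "x \<noteq> 0" and "Q x = 0"
  shows "card {P \<in> quadric_points Q. P \<subseteq> perp Q {x}} * (CARD('a) - 1) = CARD('a) ^ (r - 1) - 1"
proof -
  have "radical (perp Q {x}) = vec.span {x}"
  proof (intro set_eqI iffI)
    fix w assume "w \<in> radical (perp Q {x})"
    then show "w \<in> vec.span {x}" by (auto simp: radical_def intro: perp_perp_single)
  next
    fix w assume "w \<in> vec.span {x}"
    then obtain c where "w = c *s x" by (auto simp: vec.span_singleton)
    then show "w \<in> radical (perp Q {x})"
      using assms(5) by (auto simp: radical_iff perp_def B_left B_right B_self)
  qed
  then have rad: "card (radical (perp Q {x})) = CARD('a) ^ 1"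
    using card_span_single[OF assms(4)] by simp
  from assms(2,3) obtain k where k: "r - 1 = 1 + 2 * k"
    by (metis Suc_diff_le diff_Suc_1 dvdE nat_1_add_1 numeral_2_eq_2 plus_1_eq_Suc right_diff_distrib' mult_2
        Suc_1 diff_Suc_Suc dvd_diff_nat dvd_refl)
  have "CARD('a) * card (perp Q {x}) = CARD('a) * CARD('a) ^ Suc (r - 1)"
    using card_perp_single[OF assms(4)] assms(1,3) by simp
  then show ?thesis
    using card_quadric_points_within[OF perp_subspace _ rad k] by simp
qed

lemma card_perp_line:
  assumes "l \<in> lines"
  shows "CARD('a) ^ 2 * card (perp Q l) = CARD('a) ^ CARD('n)"
proof -
  obtain x y where xy: "x \<noteq> 0" "\<And>c. y \<noteq> c *s x" and l: "l = vec.span {x, y}"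
    using assms unfolding lines_iff by blast
  have "y \<notin> vec.span {x}" using xy(2) by (auto simp: vec.span_singleton)
  then obtain v where v: "v \<in> perp Q {x}" "B y v \<noteq> 0"
    using perp_perp_single[of y x] B_sym[of y] by (auto simp: perp_def)
  have "perp Q l = perp Q {x} \<inter> perp Q {y}"
    by (auto simp: l perp_span) (auto simp: perp_def)
  then show ?thesis
    using card_inter_perp[OF perp_subspace v] card_perp_single[OF xy(1)]
    by (simp add: power2_eq_square mult.assoc)
qed

text \<open>The double perp of \<open>l\<close> is \<open>l\<close>, so both radicals are the
  intersection of \<open>l\<close> with its perp.\<close>

lemma radical_perp_line:
  assumes "l \<in> lines"
  shows "radical (perp Q l) = radical l"
proof -
  obtain x y where l: "l = vec.span {x, y}"
    using assms unfolding lines_iff by blast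
  have "perp Q (perp Q l) \<subseteq> l"
    using perp_perp_pair by (auto simp: l perp_span)
  moreover have "l \<subseteq> perp Q (perp Q l)"
    using B_sym by (auto simp: perp_def)
  ultimately show ?thesis by (auto simp: radical_def)
qed

text \<open>The perp has the odd vector dimension \<open>r - 1\<close> and a radical of dimension 0
  or 2, so the quotient is odd-dimensional in both cases. A radical of dimension 1 would leave an
  even-dimensional one.\<close>

lemma card_quadric_points_perp_line:
  assumes "CARD('n) = r + 1" and "even r" and "r \<ge> 4" and "l \<in> lines"
    and "radical l = {0} \<or> radical l = l"
  shows "card {P \<in> quadric_points Q. P \<subseteq> perp Q l} * (CARD('a) - 1) = CARD('a) ^ (r - 2) - 1"
proof -
  from assms(2,3) obtain k where k: "r = 2 * k + 4"
    by (metis add.commute dvdE dvd_diff_nat dvd_triv_left le_add_diff_inverse mult_2_right numeral_Bit0)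
  obtain e j where e: "card (radical (perp Q l)) = CARD('a) ^ e" "r - 2 = e + 2 * j"
  proof (cases "radical l = {0}")
    case True
    then show ?thesis
      using that[of 0 "k + 1"] k by (simp add: radical_perp_line[OF assms(4)])
  next
    case False
    then show ?thesis
      using that[of 2 k] k assms(5) by (simp add: radical_perp_line[OF assms(4)] card_line[OF assms(4)])
  qed
  have "CARD('a) ^ 2 * card (perp Q l) = CARD('a) ^ 2 * CARD('a) ^ Suc (r - 2)"
    unfolding card_perp_line[OF assms(4)] power_add[symmetric] assms(1)
    using assms(3) by (intro arg_cong[where f="\<lambda>e. CARD('a) ^ e"]) simp
  then have "card (perp Q l) = CARD('a) ^ Suc (r - 2)"
    by simp
  then show ?thesis
    using card_quadric_points_within[OF perp_subspace _ e] by blast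
qed


section \<open>Types of lines\<close>

lemma totally_singular_iff:
  assumes "vec.subspace W"
  shows "(\<forall>x\<in>W. Q x = 0) \<longleftrightarrow> radical W = W"
proof
  assume *: "\<forall>x\<in>W. Q x = 0"
  then have "B x y = 0" if "x \<in> W" "y \<in> W" for x y
    using that assms by (auto simp: polar_form_def vec.subspace_add)
  then show "radical W = W" by (auto simp: radical_iff)
qed (use Q_radical in blast)

text \<open>Take \<open>z\<close> in \<open>l\<close> not orthogonal to \<open>x\<close> and
  subtract the multiple of \<open>x\<close> that cancels \<open>Q z\<close>.\<close>

lemma hyperbolic_basis:
  assumes l: "l \<in> lines" and rad: "radical l = {0}" and x: "x \<in> l" "x \<noteq> 0" "Q x = 0"
  obtains y where "\<And>c. y \<noteq> c *s x" "l = vec.span {x, y}" "Q y = 0" "B x y \<noteq> 0"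
proof -
  have "x \<notin> radical l" using rad x by blast
  then obtain z where z: "z \<in> l" "B x z \<noteq> 0" using x by (auto simp: radical_iff)
  define y where "y = z - (Q z / B x z) *s x"
  have sub: "vec.subspace l" using l by (simp add: lines_def)
  have xx: "B x x = 0" using x(3) by (simp add: B_self)
  have yl: "y \<in> l" using sub z x by (simp add: y_def vec.subspace_diff vec.subspace_scale)
  have xy: "B x y \<noteq> 0" using z xx by (simp add: y_def B_right)
  have "y + (Q z / B x z) *s x = z" by (simp add: y_def)
  then have "Q z = Q y + Q z / B x z * B x y"
    using x(3) by (metis Q_add Q_scale B_right(2) B_sym mult_zero_right add.right_neutral)
  moreover have "B x y = B x z" by (simp add: y_def B_right xx)
  ultimately have Qy: "Q y = 0" using z by simp
  have ind: "y \<noteq> c *s x" for c using xy xx by (auto simp: B_right)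
  with yl Qy xy show ?thesis
    using that line_basis[OF l x(1) yl x(2)] by blast
qed

text \<open>Nondegenerate lines have 0 or 2 singular points and totally singular ones
  \<open>CARD('a) + 1\<close>; the remaining, tangent lines have exactly one. This replaces point
  counts by radicals from here on.\<close>

lemma card_quadric_points_on_line_iff:
  assumes l: "l \<in> lines"
  shows "card {P \<in> quadric_points Q. P \<subseteq> l} \<in> {0, 2, CARD('a) + 1} \<longleftrightarrow>
    radical l = {0} \<or> radical l = l"
proof -
  let ?P = "{P \<in> quadric_points Q. P \<subseteq> l}"
  have sub: "vec.subspace l" using l by (simp add: lines_def)
  have P: "?P = {vec.span {x} | x. x \<in> l \<and> x \<noteq> 0 \<and> Q x = 0}"
  proof (intro set_eqI iffI)
    fix P assume "P \<in> ?P"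
    then obtain x where "x \<noteq> 0" "P = vec.span {x}" "\<forall>x\<in>P. Q x = 0" "P \<subseteq> l"
      by (auto simp: quadric_points_def points_iff)
    then show "P \<in> {vec.span {x} | x. x \<in> l \<and> x \<noteq> 0 \<and> Q x = 0}"
      using vec.span_base[of x "{x}"] by blast
  next
    fix P assume "P \<in> {vec.span {x} | x. x \<in> l \<and> x \<noteq> 0 \<and> Q x = 0}"
    then show "P \<in> ?P"
      using sub by (auto simp: quadric_points_def points_iff vec.span_singleton Q_scale vec.subspace_scale)
  qed
  consider (nondeg) "radical l = {0}" | (total) "radical l = l" "radical l \<noteq> {0}"
    | (tangent) "radical l \<noteq> {0}" "radical l \<noteq> l" by blast
  then show ?thesis
  proof cases
    case nondeg
    show ?thesis
    proof (cases "\<exists>x\<in>l. x \<noteq> 0 \<and> Q x = 0")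
      case False
      then have "?P = {}" unfolding P by blast
      then show ?thesis using nondeg by simp
    next
      case True
      then obtain x where x: "x \<in> l" "x \<noteq> 0" "Q x = 0" by blast
      obtain y where y: "\<And>c. y \<noteq> c *s x" "l = vec.span {x, y}" "Q y = 0" "B x y \<noteq> 0"
        using hyperbolic_basis[OF l nondeg x] by blast
      have y0: "y \<noteq> 0" using y(1)[of 0] by simp
      have yl: "y \<in> l" unfolding y(2) by (rule vec.span_base) simp
      have scale: "vec.span {c *s v} = vec.span {v}" if "c \<noteq> 0" for c :: 'a and v :: "'a ^ 'n"
        using vec.span_image_scale[of "{v}" "\<lambda>_. c"] that by simp
      have "?P = {vec.span {x}, vec.span {y}}"
      proof
        show "?P \<subseteq> {vec.span {x}, vec.span {y}}"
        proof -
          have "vec.span {v} \<in> {vec.span {x}, vec.span {y}}" if v: "v \<in> l" "v \<noteq> 0" "Q v = 0" for v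
          proof -
            obtain s t where st: "v = s *s x + t *s y" using v(1) by (auto simp: y(2) span_pair)
            have "s * t = 0" using v(3) x(3) y(3,4) by (simp add: st Q_combination)
            then show ?thesis using v(2) by (auto simp: st scale)
          qed
          then show ?thesis unfolding P by blast
        qed
        show "{vec.span {x}, vec.span {y}} \<subseteq> ?P"
          unfolding P using x y(3) y0 yl by blast
      qed
      moreover have "vec.span {x} \<noteq> vec.span {y}"
        using vec.span_base[of y "{y}"] y(1) by (auto simp: vec.span_singleton)
      ultimately show ?thesis using nondeg by simp
    qed
  next
    case total
    then have "?P = {P \<in> points. P \<subseteq> l}"
      using totally_singular_iff[OF sub] by (auto simp: quadric_points_def)
    then have "card ?P = CARD('a) + 1"
      using card_points_subspace(2)[OF sub card_line[OF l]] by simp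
    then show ?thesis using total by simp
  next
    case tangent
    have "0 \<in> radical l" using vec.subspace_0[OF subspace_radical[OF sub]] .
    then obtain w where w: "w \<in> radical l" "w \<noteq> 0" using tangent(1) by blast
    have wl: "w \<in> l" and Bw: "\<And>v. v \<in> l \<Longrightarrow> B w v = 0"
      using w by (auto simp: radical_iff)
    have Qw: "Q w = 0" using Q_radical w(1) .
    \<comment> \<open>A singular vector outside the span of \<open>w\<close> would form a basis of
      \<open>l\<close> together with \<open>w\<close>; being orthogonal to \<open>w\<close>, it
      would make \<open>Q\<close> vanish on \<open>l\<close>.\<close>
    have "vec.span {v} = vec.span {w}" if v: "v \<in> l" "v \<noteq> 0" "Q v = 0" for v
    proof (rule ccontr)
      assume ne: "vec.span {v} \<noteq> vec.span {w}"
      have ind: "v \<noteq> c *s w" for c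
        using ne vec.span_image_scale[of "{w}" "\<lambda>_. c"] v(2) by (cases "c = 0") auto
      have "l = vec.span {w, v}"
        using line_basis[OF l wl v(1) w(2) ind] .
      then have "\<forall>u\<in>l. Q u = 0"
        using Qw v(3) Bw[OF v(1)] by (auto simp: span_pair Q_combination)
      then show False using tangent(2) totally_singular_iff[OF sub] by blast
    qed
    then have "?P = {vec.span {w}}"
      unfolding P using w(2) Qw wl by blast
    then show ?thesis using tangent by simp
  qed
qed

text \<open>If \<open>l\<close> is not totally singular, a nonzero radical vector would make the
  Gram determinant of \<open>x\<close> and \<open>y\<close> vanish and so exhibit \<alpha> as a
  square. Conversely, a basis is built separately for totally singular, hyperbolic and anisotropic
  lines.\<close>

lemma nonsquare_basis_iff:
  assumes l: "l \<in> lines" and \<alpha>: "\<And>c. c\<^sup>2 \<noteq> \<alpha>"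
  shows "(\<exists>x y. x \<noteq> 0 \<and> (\<forall>c. y \<noteq> c *s x) \<and> l = vec.span {x, y} \<and> Q x = \<alpha> * Q y) \<longleftrightarrow>
    radical l = {0} \<or> radical l = l"
proof
  assume "\<exists>x y. x \<noteq> 0 \<and> (\<forall>c. y \<noteq> c *s x) \<and> l = vec.span {x, y} \<and> Q x = \<alpha> * Q y"
  then obtain x y where xy: "x \<noteq> 0" "\<And>c. y \<noteq> c *s x" and lxy: "l = vec.span {x, y}"
    and Q: "Q x = \<alpha> * Q y" by blast
  have sub: "vec.subspace l" using l by (simp add: lines_def)
  have in_l: "x \<in> l" "y \<in> l" unfolding lxy by (auto intro: vec.span_base)
  show "radical l = {0} \<or> radical l = l"
  proof (rule disjCI)
    assume nt: "radical l \<noteq> l"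
    have "w = 0" if w: "w \<in> radical l" for w
    proof -
      obtain s t where st: "w = s *s x + t *s y"
        using w by (auto simp: radical_iff lxy span_pair)
      have "B w x = 0" "B w y = 0" using w in_l by (auto simp: radical_iff)
      then have e1: "2 * s * Q x + t * B x y = 0" and e2: "s * B x y + 2 * t * Q y = 0"
        by (simp_all add: st B_left B_self B_sym[of y x] mult_ac)
      show "w = 0"
      proof (cases "Q y = 0")
        case True
        have "B x y \<noteq> 0"
        proof
          assume "B x y = 0"
          then have "\<forall>u\<in>l. Q u = 0" using True Q by (auto simp: lxy span_pair Q_combination)
          then show False using nt totally_singular_iff[OF sub] by blast
        qed
        then show ?thesis using e1 e2 True Q st by simp
      next
        case False
        \<comment> \<open>Elimination of \<open>t\<close> from \<open>e1\<close> and
          \<open>e2\<close>. The factor of \<open>s\<close> is the Gram determinant of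
          \<open>x\<close> and \<open>y\<close>, rewritten by
          \<open>Q x = \<alpha> * Q y\<close>.\<close>
        have "s * (4 * \<alpha> * (Q y)\<^sup>2 - (B x y)\<^sup>2) = 2 * Q y * (2 * s * Q x + t * B x y) - B x y * (s * B x y + 2 * t * Q y)"
          by (simp add: Q power2_eq_square algebra_simps)
        also have "\<dots> = 0" using e1 e2 by simp
        finally have "s * (4 * \<alpha> * (Q y)\<^sup>2 - (B x y)\<^sup>2) = 0" .
        moreover have "4 * \<alpha> * (Q y)\<^sup>2 \<noteq> (B x y)\<^sup>2"
        proof
          assume "4 * \<alpha> * (Q y)\<^sup>2 = (B x y)\<^sup>2"
          then have "(B x y / (2 * Q y))\<^sup>2 = \<alpha>"
            using False by (simp add: power_divide power_mult_distrib field_simps)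
          then show False using \<alpha> by blast
        qed
        ultimately have "s = 0" by simp
        then show ?thesis using e2 False st by simp
      qed
    qed
    then show "radical l = {0}"
      using vec.subspace_0[OF subspace_radical[OF sub]] by blast
  qed
next
  assume good: "radical l = {0} \<or> radical l = l"
  have sub: "vec.subspace l" using l by (simp add: lines_def)
  obtain x y where xy: "x \<noteq> 0" "\<And>c. y \<noteq> c *s x" and lxy: "l = vec.span {x, y}"
    using l unfolding lines_iff by blast
  have in_l: "x \<in> l" "y \<in> l" unfolding lxy by (auto intro: vec.span_base)
  show "\<exists>x y. x \<noteq> 0 \<and> (\<forall>c. y \<noteq> c *s x) \<and> l = vec.span {x, y} \<and> Q x = \<alpha> * Q y"
  proof (cases "radical l = l")
    case True
    then have "Q x = \<alpha> * Q y" using totally_singular_iff[OF sub] in_l by auto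
    then show ?thesis using xy lxy by blast
  next
    case False
    then have rad: "radical l = {0}" using good by blast
    show ?thesis
    proof (cases "\<exists>x\<in>l. x \<noteq> 0 \<and> Q x = 0")
      case True
      then obtain x where x: "x \<in> l" "x \<noteq> 0" "Q x = 0" by blast
      obtain y where y: "\<And>c. y \<noteq> c *s x" "l = vec.span {x, y}" "Q y = 0"
        using hyperbolic_basis[OF l rad x] by metis
      \<comment> \<open>In a hyperbolic pair both vectors are singular, so the required equation
        reads 0 = 0.\<close>
      then show ?thesis using x by (intro exI[of _ x] exI[of _ y]) simp
    next
      case False
      then have anis: "Q v \<noteq> 0" if "v \<in> l" "v \<noteq> 0" for v using that by blast
      have Qx: "Q x \<noteq> 0" using anis in_l xy(1) by blast
      define z where "z = y - (B x y / (2 * Q x)) *s x"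
      have zl: "z \<in> l" using sub in_l by (simp add: z_def vec.subspace_diff vec.subspace_scale)
      have "z \<noteq> 0" using xy(2) by (simp add: z_def)
      then have Qz: "Q z \<noteq> 0" using anis zl by blast
      have xz: "B x z = 0" using Qx by (simp add: z_def B_right B_self)
      \<comment> \<open>The orthogonal basis \<open>x\<close>, \<open>z\<close> represents every
        scalar, in particular \<open>\<alpha> * Q x\<close>. The resulting \<open>u\<close> is
        independent of \<open>x\<close> because proportional vectors have values of \<open>Q\<close>
        differing by a square factor.\<close>
      obtain s t where st: "Q x * s\<^sup>2 + Q z * t\<^sup>2 = \<alpha> * Q x"
        using binary_form_universal[OF odd_card Qx Qz] by blast
      define u where "u = s *s x + t *s z"
      have Qu: "Q u = \<alpha> * Q x" using st xz by (simp add: u_def Q_combination mult.commute)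
      have ul: "u \<in> l" using sub in_l zl by (simp add: u_def vec.subspace_add vec.subspace_scale)
      have "\<alpha> \<noteq> 0" using \<alpha>[of 0] by auto
      then have u0: "u \<noteq> 0" using Qu Qx by auto
      have ind: "x \<noteq> c *s u" for c
      proof
        assume "x = c *s u"
        then have "Q x = c\<^sup>2 * (\<alpha> * Q x)" by (metis Q_scale Qu)
        then have "c\<^sup>2 * \<alpha> = 1" using Qx by (metis mult.assoc mult_cancel_right2)
        moreover from this have "c \<noteq> 0" by auto
        ultimately have "(1 / c)\<^sup>2 = \<alpha>" by (simp add: field_simps)
        then show False using \<alpha> by blast
      qed
      show ?thesis
        using u0 ind line_basis[OF l ul in_l(1) u0 ind] Qu by blast
    qed
  qed
qed

section \<open>Incidences of a line cover\<close>

lemma cover_lines: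
  assumes "line_cover Q m L" and "k \<in> L"
  shows "k \<in> lines" and "vec.subspace k" and "\<And>x. x \<in> k \<Longrightarrow> Q x = 0"
  using assms by (auto simp: line_cover_def quadric_lines_def lines_def)

text \<open>Double count of the incident pairs of a cover line and a singular point of
  \<open>W\<close>. Every point of a cover line is singular, so the left side can range over all
  \<open>points\<close>.\<close>

lemma cover_incidences:
  assumes "line_cover Q m L"
  shows "(\<Sum>k\<in>L. card {P \<in> points. P \<subseteq> k \<inter> W}) = m * card {P \<in> quadric_points Q. P \<subseteq> W}"
proof -
  let ?T = "{P \<in> quadric_points Q. P \<subseteq> W}"
  have "(\<Sum>k\<in>L. card {P \<in> ?T. P \<subseteq> k}) = (\<Sum>P\<in>?T. m)"
    by (rule sum_multicount_gen) (use assms in \<open>auto simp: line_cover_def\<close>)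
  moreover have "{P \<in> ?T. P \<subseteq> k} = {P \<in> points. P \<subseteq> k \<inter> W}" if "k \<in> L" for k
    using cover_lines(3)[OF assms that] by (auto simp: quadric_points_def)
  ultimately show ?thesis by simp
qed

lemma card_cover:
  assumes "line_cover Q m L"
  shows "(CARD('a) + 1) * card L = m * card (quadric_points Q)"
proof -
  have "card {P \<in> points. P \<subseteq> k \<inter> UNIV} = CARD('a) + 1" if "k \<in> L" for k
    using card_points_subspace(2)[of k] cover_lines(1,2)[OF assms that] by (simp add: card_line)
  then show ?thesis
    using cover_incidences[OF assms, of UNIV] by (simp add: mult.commute)
qed

text \<open>A cover line has \<open>CARD('a) + 1\<close> points in the hyperplane if it is contained
  in it and one point otherwise: each line contributes 1 and the contained ones
  \<open>CARD('a)\<close> more.\<close>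

lemma card_cover_perp_point:
  assumes "line_cover Q m L"
  shows "CARD('a) * card {k \<in> L. k \<subseteq> perp Q {x}} + card L
    = m * card {P \<in> quadric_points Q. P \<subseteq> perp Q {x}}"
proof -
  have "card {P \<in> points. P \<subseteq> k \<inter> perp Q {x}} = (if k \<subseteq> perp Q {x} then CARD('a) else 0) + 1"
    if k: "k \<in> L" for k
  proof (cases "k \<subseteq> perp Q {x}")
    case True
    then have "k \<inter> perp Q {x} = k" by blast
    then show ?thesis
      using True card_points_subspace(2)[of k] cover_lines(1,2)[OF assms k] by (simp add: card_line)
  next
    case False
    then obtain y where "y \<in> k" "B x y \<noteq> 0" by (auto simp: perp_def)
    then have "CARD('a) * card (k \<inter> perp Q {x}) = CARD('a) * CARD('a)"
      using card_inter_perp[OF cover_lines(2)[OF assms k]] card_line[OF cover_lines(1)[OF assms k]]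
      by (simp add: power2_eq_square)
    then have "card (k \<inter> perp Q {x}) = CARD('a)" by simp
    then show ?thesis
      using False card_points_subspace(1)[OF subspace_inter_perp[OF cover_lines(2)[OF assms k]]]
      by simp
  qed
  then have "(\<Sum>k\<in>L. card {P \<in> points. P \<subseteq> k \<inter> perp Q {x}}) =
      (\<Sum>k\<in>L. (if k \<subseteq> perp Q {x} then CARD('a) else 0) + 1)"
    by (rule sum.cong[OF refl])
  also have "\<dots> = (\<Sum>k\<in>L. if k \<subseteq> perp Q {x} then CARD('a) else 0) + (\<Sum>k\<in>L. 1)"
    by (rule sum.distrib)
  also have "(\<Sum>k\<in>L. if k \<subseteq> perp Q {x} then CARD('a) else 0) = card {k \<in> L. k \<subseteq> perp Q {x}} * CARD('a)"
    by (simp flip: sum.inter_filter)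
  finally show ?thesis
    unfolding cover_incidences[OF assms] by (simp add: mult.commute)
qed

end


section \<open>The quadratic extension\<close>

lemma field_embedding_simps:
  assumes "field_embedding \<iota>"
  shows "\<iota> (x + y) = \<iota> x + \<iota> y" "\<iota> (x * y) = \<iota> x * \<iota> y" "\<iota> 1 = 1" "\<iota> 0 = 0" "\<iota> (- x) = - \<iota> x"
    "\<iota> (x - y) = \<iota> x - \<iota> y" "\<iota> (x ^ n) = \<iota> x ^ n" "\<iota> x = \<iota> y \<longleftrightarrow> x = y" "\<iota> x = 0 \<longleftrightarrow> x = 0"
proof -
  have a: "\<iota> (x + y) = \<iota> x + \<iota> y" "\<iota> (x * y) = \<iota> x * \<iota> y" "\<iota> 1 = 1" for x y
    using assms by (auto simp: field_embedding_def)
  show "\<iota> (x + y) = \<iota> x + \<iota> y" "\<iota> (x * y) = \<iota> x * \<iota> y" "\<iota> 1 = 1" by (fact a)+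
  have z: "\<iota> 0 = 0" using a(1)[of 0 0] by (metis add.right_neutral add_cancel_left_right)
  have m: "\<iota> (- x) = - \<iota> x" for x
    using a(1)[of x "- x"] z by (metis add.right_inverse minus_unique)
  have d: "\<iota> (x - y) = \<iota> x - \<iota> y" for x y using a(1)[of x "- y"] m by simp
  have nz: "\<iota> x = 0 \<longleftrightarrow> x = 0" for x
    using a(2)[of x "inverse x"] a(3) z by (metis mult_zero_left right_inverse zero_neq_one)
  show "\<iota> 0 = 0" "\<iota> (- x) = - \<iota> x" "\<iota> (x - y) = \<iota> x - \<iota> y" "\<iota> x = 0 \<longleftrightarrow> x = 0" by (fact z m d nz)+
  show "\<iota> (x ^ n) = \<iota> x ^ n" by (induction n) (simp_all add: a)
  show "\<iota> x = \<iota> y \<longleftrightarrow> x = y" using d nz by (metis right_minus_eq)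
qed

text \<open>The polynomial \<open>p\<close> has degree at most \<open>CARD('a)\<close>, and the
  image of \<iota> already supplies that many roots.\<close>

lemma fixed_by_frobenius:
  fixes \<iota> :: "'a::{field,finite} \<Rightarrow> 'b::field"
  assumes "field_embedding \<iota>" and "c ^ CARD('a) = c"
  shows "c \<in> range \<iota>"
proof (rule ccontr)
  assume c: "c \<notin> range \<iota>"
  let ?q = "CARD('a)"
  define p :: "'b poly" where "p = monom 1 ?q - monom 1 1"
  have q: "?q \<ge> 2" by (rule card_field_ge_2)
  have "coeff p ?q = 1" using q by (simp add: p_def)
  then have p0: "p \<noteq> 0" by auto
  have "degree p \<le> ?q"
    unfolding p_def using q by (intro degree_diff_le) (auto simp: degree_monom_eq)
  have roots: "insert c (range \<iota>) \<subseteq> {x. poly p x = 0}"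
    using assms(2) power_card_eq_self[where 'k='a]
    by (auto simp: p_def poly_monom simp flip: field_embedding_simps(7)[OF assms(1)])
  have "card (insert c (range \<iota>)) \<le> degree p"
    using card_mono[OF poly_roots_finite[OF p0] roots] card_poly_roots_bound[OF p0] by linarith
  moreover have "card (range \<iota>) = ?q"
    by (rule card_image) (simp add: inj_on_def field_embedding_simps(8)[OF assms(1)])
  ultimately show False
    using c \<open>degree p \<le> ?q\<close> by simp
qed

text \<open>For \<open>w\<close> outside the subfield, \<open>w\<close> minus its conjugate is
  negated by Frobenius, so its square is fixed and lies in the subfield. A square root of \<alpha>
  in the subfield would equal \<omega> up to sign; then \<omega> would be fixed as well as negated,
  hence 0.\<close>

lemma nonsquare_root_exists:
  fixes \<iota> :: "'a::{field,finite} \<Rightarrow> 'b::{field,finite}"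
  assumes "primepow CARD('a)" and "odd CARD('a)" and "CARD('b) = CARD('a)\<^sup>2" and "field_embedding \<iota>"
  obtains \<omega> \<alpha> where "\<omega> ^ CARD('a) = - \<omega>" and "\<omega>\<^sup>2 = \<iota> \<alpha>" and "\<And>c. c\<^sup>2 \<noteq> \<alpha>"
proof -
  let ?q = "CARD('a)"
  have two: "(2 :: 'b) \<noteq> 0" using assms(2,3) by (intro two_neq_0) simp
  have "card (range \<iota>) \<le> ?q" by (rule card_image_le) simp
  also have "?q < CARD('b)" using card_field_ge_2[where 'k='a] by (simp add: assms(3) power2_eq_square)
  finally obtain w where w: "w \<notin> range \<iota>" by (metis UNIV_eq_I less_irrefl)
  define \<omega> where "\<omega> = w - w ^ ?q"
  have add: "(x + y) ^ ?q = x ^ ?q + y ^ ?q" for x y :: 'b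
    by (rule power_primepow_add[OF assms(1,3)])
  have diff: "(x - y) ^ ?q = x ^ ?q - y ^ ?q" for x y :: 'b
    using add[of "x - y" y] by simp
  have "(w ^ ?q) ^ ?q = w"
    using power_card_eq_self[of w] by (simp add: assms(3) power2_eq_square power_mult)
  then have 1: "\<omega> ^ ?q = - \<omega>" by (simp add: \<omega>_def diff)
  have 0: "\<omega> \<noteq> 0" using fixed_by_frobenius[OF assms(4), of w] w by (auto simp: \<omega>_def)
  have "(\<omega>\<^sup>2) ^ ?q = \<omega>\<^sup>2"
    using 1 by (simp flip: power_mult add: mult.commute[of 2]) (simp add: power_mult)
  then obtain \<alpha> where 2: "\<omega>\<^sup>2 = \<iota> \<alpha>" using fixed_by_frobenius[OF assms(4)] by blast
  have 3: "c\<^sup>2 \<noteq> \<alpha>" for c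
  proof
    assume "c\<^sup>2 = \<alpha>"
    then have "\<omega>\<^sup>2 = (\<iota> c)\<^sup>2" by (simp add: 2 flip: field_embedding_simps(7)[OF assms(4)])
    then have "\<omega> = \<iota> c \<or> \<omega> = \<iota> (- c)" by (auto simp: power2_eq_iff field_embedding_simps(5)[OF assms(4)])
    then obtain d where d: "\<omega> = \<iota> d" by blast
    then have "\<omega> ^ ?q = \<omega>"
      using power_card_eq_self[of d] by (metis field_embedding_simps(7)[OF assms(4)])
    then have "2 * \<omega> = 0" using 1 by (metis add.right_inverse mult_2)
    then show False using 0 two by simp
  qed
  show ?thesis using that 1 2 3 by blast
qed

locale hermitian_extension = odd_quadratic_space Q
  for Q :: "'a::{field,finite} ^ 'n::finite \<Rightarrow> 'a" +
  fixes \<iota> :: "'a \<Rightarrow> 'b::{field,finite}" and \<omega> :: 'b and \<alpha> :: 'a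
  assumes embedding: "field_embedding \<iota>"
    and primepow_card: "primepow CARD('a)"
    and card_extension: "CARD('b) = CARD('a)\<^sup>2"
    and frobenius_omega: "\<omega> ^ CARD('a) = - \<omega>"
    and omega_square: "\<omega>\<^sup>2 = \<iota> \<alpha>"
    and nonsquare: "c\<^sup>2 \<noteq> \<alpha>"
begin

section \<open>Components over the small field\<close>

lemmas iota_simps = field_embedding_simps[OF embedding]

abbreviation E where "E \<equiv> extend_vec \<iota>"

abbreviation EB where "EB \<equiv> extended_polar_form \<iota> Q"

abbreviation H where "H x y \<equiv> EB x (frobenius_vec CARD('a) y)"

text \<open>The analogue of writing a complex vector by real and imaginary parts;
  \<open>frobenius_vec\<close> acts as conjugation.\<close>

definition vec_of :: "'a ^ 'n \<Rightarrow> 'a ^ 'n \<Rightarrow> 'b ^ 'n" where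
  "vec_of x y = E x + \<omega> *s E y"

lemma E_simps: "E (x + y) = E x + E y" "E (c *s x) = \<iota> c *s E x" "E 0 = 0" "E (- x) = - E x"
  by (simp_all add: extend_vec_def vec_eq_iff iota_simps)

text \<open>A relation with \<open>t \<noteq> t'\<close> would, after squaring, exhibit \<alpha> as
  a square in the small field.\<close>

lemma scalar_unique:
  assumes "\<iota> s + \<omega> * \<iota> t = \<iota> s' + \<omega> * \<iota> t'"
  shows "s = s' \<and> t = t'"
proof -
  have eq: "\<omega> * \<iota> (t - t') = \<iota> (s' - s)"
    using assms by (simp add: iota_simps algebra_simps)
  have "t = t'"
  proof (rule ccontr)
    assume "t \<noteq> t'"
    have "\<iota> \<alpha> * (\<iota> (t - t'))\<^sup>2 = (\<iota> (s' - s))\<^sup>2"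
      by (metis eq omega_square power_mult_distrib)
    then have "\<alpha> * (t - t')\<^sup>2 = (s' - s)\<^sup>2"
      by (simp flip: iota_simps(2,7) add: iota_simps(8))
    then have "((s' - s) / (t - t'))\<^sup>2 = \<alpha>"
      using \<open>t \<noteq> t'\<close> by (simp add: field_simps)
    then show False using nonsquare by blast
  qed
  with eq show ?thesis by (simp add: iota_simps)
qed

text \<open>An injective map from pairs of small scalars into a field with
  \<open>CARD('a)\<^sup>2\<close> elements is onto.\<close>

lemma scalar_decomposition: obtains s t where "c = \<iota> s + \<omega> * \<iota> t"
proof -
  let ?f = "\<lambda>(s, t). \<iota> s + \<omega> * \<iota> t"
  have "inj ?f" using scalar_unique by (auto intro!: injI)
  then have "card (range ?f) = CARD('b)"
    by (simp add: card_image card_extension power2_eq_square)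
  then have "range ?f = UNIV" by (intro card_subset_eq) auto
  then have "c \<in> range ?f" by simp
  then show ?thesis using that by auto
qed

lemma vec_of_eq_iff: "vec_of x y = vec_of x' y' \<longleftrightarrow> x = x' \<and> y = y'"
  by (auto simp: vec_of_def extend_vec_def vec_eq_iff dest!: scalar_unique)

lemma vec_of_decomposition: obtains x y where "v = vec_of x y"
proof -
  have "\<exists>s t. v $ i = \<iota> s + \<omega> * \<iota> t" for i by (metis scalar_decomposition)
  then obtain s t where "v $ i = \<iota> (s i) + \<omega> * \<iota> (t i)" for i by metis
  then have "v = vec_of (\<chi> i. s i) (\<chi> i. t i)"
    by (simp add: vec_of_def extend_vec_def vec_eq_iff)
  then show ?thesis using that by blast
qed

lemma vec_of_0 [simp]: "vec_of 0 0 = 0"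
  by (simp add: vec_of_def E_simps)

lemma vec_of_eq_0_iff: "vec_of x y = 0 \<longleftrightarrow> x = 0 \<and> y = 0"
  using vec_of_eq_iff[of x y 0 0] by simp

lemma vec_of_add: "vec_of x y + vec_of x' y' = vec_of (x + x') (y + y')"
  by (simp add: vec_of_def E_simps vector_add_ldistrib)

lemma vec_of_scale:
  "(\<iota> s + \<omega> * \<iota> t) *s vec_of x y = vec_of (s *s x + (\<alpha> * t) *s y) (s *s y + t *s x)"
proof -
  have "(\<iota> s + \<omega> * \<iota> t) *s vec_of x y
      = \<iota> s *s E x + (\<omega>\<^sup>2 * \<iota> t) *s E y + \<omega> *s (\<iota> s *s E y + \<iota> t *s E x)"
    by (simp add: vec_of_def vec_eq_iff algebra_simps power2_eq_square)
  then show ?thesis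
    unfolding omega_square by (simp add: vec_of_def E_simps iota_simps)
qed

lemma frob_vec_of: "frobenius_vec CARD('a) (vec_of x y) = vec_of x (- y)"
proof -
  have "(a + b) ^ CARD('a) = a ^ CARD('a) + b ^ CARD('a)" for a b :: 'b
    using power_primepow_add[OF primepow_card card_extension] .
  moreover have "\<iota> a ^ CARD('a) = \<iota> a" for a
    by (simp flip: iota_simps(7) add: power_card_eq_self)
  ultimately show ?thesis
    by (simp add: frobenius_vec_def vec_of_def extend_vec_def vec_eq_iff power_mult_distrib
        frobenius_omega iota_simps)
qed

lemma frob_scale: "frobenius_vec CARD('a) (c *s v) = c ^ CARD('a) *s frobenius_vec CARD('a) v"
  by (simp add: frobenius_vec_def vec_eq_iff power_mult_distrib)

section \<open>The extended bilinear form and the Hermitian form in components\<close>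

lemma EB_left: "EB (x + y) z = EB x z + EB y z" "EB (c *s x) z = c * EB x z" "EB 0 z = 0"
  by (simp_all add: extended_polar_form_def algebra_simps sum.distrib sum_distrib_left)

lemma EB_right: "EB z (x + y) = EB z x + EB z y" "EB z (c *s x) = c * EB z x" "EB z 0 = 0"
  "EB z (- x) = - EB z x" "EB z (x - y) = EB z x - EB z y"
  by (simp_all add: extended_polar_form_def algebra_simps sum.distrib sum_distrib_left sum_negf
      sum_subtractf)

lemma EB_linear: "Vector_Spaces.linear (*s) (*) (\<lambda>x. EB x z)"
  by (simp add: Vector_Spaces.linear_iff EB_left vec.vector_space_axioms vector_space_over_itself.vector_space_axioms)

lemma B_sum: "B x (sum f A) = (\<Sum>i\<in>A. B x (f i))"
  by (induction A rule: infinite_finite_induct) (simp_all add: B_right)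

lemma iota_sum: "\<iota> (sum f A) = (\<Sum>i\<in>A. \<iota> (f i))"
  by (induction A rule: infinite_finite_induct) (simp_all add: iota_simps)

text \<open>Brings \<open>B\<close> into the Gram matrix shape used to define
  \<open>extended_polar_form\<close>, so that the two forms can be compared on extended
  vectors.\<close>

lemma B_coordinates: "B x y = (\<Sum>i\<in>UNIV. \<Sum>j\<in>UNIV. B (axis i 1) (axis j 1) * x $ i * y $ j)"
proof -
  have *: "B z w = (\<Sum>j\<in>UNIV. w $ j * B z (axis j 1))" for z w
  proof -
    have "w = (\<Sum>j\<in>UNIV. w $ j *s axis j 1)" by (rule basis_expansion[symmetric])
    then have "B z w = B z (\<Sum>j\<in>UNIV. w $ j *s axis j 1)" by simp
    then show ?thesis by (simp add: B_sum B_right)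
  qed
  have "B x y = (\<Sum>i\<in>UNIV. x $ i * B (axis i 1) y)"
    using *[of y x] by (simp add: B_sym[of y])
  also have "\<dots> = (\<Sum>i\<in>UNIV. \<Sum>j\<in>UNIV. B (axis i 1) (axis j 1) * x $ i * y $ j)"
    by (simp add: *[of _ y] sum_distrib_left mult_ac)
  finally show ?thesis .
qed

lemma EB_E: "EB (E x) (E y) = \<iota> (B x y)"
  by (simp add: B_coordinates[of x] extended_polar_form_def iota_sum iota_simps extend_vec_def)

lemma EB_vec_of:
  "H (vec_of x y) (vec_of u v) = \<iota> (B x u - \<alpha> * B y v) + \<omega> * \<iota> (B y u - B x v)"
proof -
  have "H (vec_of x y) (vec_of u v)
      = \<iota> (B x u) - \<omega> * \<iota> (B x v) + \<omega> * \<iota> (B y u) - \<omega>\<^sup>2 * \<iota> (B y v)"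
    unfolding frob_vec_of
    by (simp add: vec_of_def EB_left EB_right EB_E E_simps(4) power2_eq_square algebra_simps)
  then show ?thesis
    by (simp add: omega_square iota_simps algebra_simps)
qed

text \<open>One Hermitian equation over the large field splits into its components at 1 and at
  \<omega>.\<close>

lemma EB_vec_of_eq_0_iff:
  "H (vec_of x y) (vec_of u v) = 0 \<longleftrightarrow> B x u = \<alpha> * B y v \<and> B y u = B x v"
  unfolding EB_vec_of using scalar_unique[of "B x u - \<alpha> * B y v" "B y u - B x v" 0 0]
  by (auto simp: iota_simps)

lemma hermitian_perp_span:
  "hermitian_perp CARD('a) \<iota> Q (vec.span {v}) = {y. H y v = 0}"
proof -
  have "H y v = 0" if "\<forall>c. H y (c *s v) = 0" for y
    using spec[OF that, of 1] by simp
  then show ?thesis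
    by (auto simp: hermitian_perp_def vec.span_singleton frob_scale EB_right)
qed

text \<open>A generator suffices, since scaling it by \<open>c\<close> multiplies the value by
  \<open>c\<close> times its conjugate. The component at \<omega> vanishes by symmetry of
  \<open>B\<close>; the other is halved.\<close>

lemma hermitian_points_span:
  "vec.span {vec_of x y} \<in> hermitian_points CARD('a) \<iota> Q \<longleftrightarrow>
    vec_of x y \<noteq> 0 \<and> Q x = \<alpha> * Q y"
proof -
  have "H (vec_of x y) (vec_of x y) = 0 \<longleftrightarrow> 2 * Q x = 2 * (\<alpha> * Q y)"
    by (simp add: EB_vec_of_eq_0_iff B_self B_sym[of y] mult.left_commute)
  moreover have "(\<forall>v\<in>vec.span {vec_of x y}. H v v = 0) \<longleftrightarrow> H (vec_of x y) (vec_of x y) = 0"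
    by (auto simp: vec.span_singleton frob_scale EB_right EB_left)
  moreover have "vec.span {vec_of x y} \<in> points \<longleftrightarrow> vec_of x y \<noteq> 0"
  proof
    assume "vec.span {vec_of x y} \<in> points"
    then show "vec_of x y \<noteq> 0" by (auto simp: points_def)
  qed (auto simp: points_iff)
  ultimately show ?thesis
    by (simp add: hermitian_points_def)
qed

section \<open>Extensions of subspaces\<close>

text \<open>The right side is closed under large scalars by \<open>vec_of_scale\<close>, contains
  the image of \<open>W\<close>, and lies in the span of that image. Any subspace \<open>W\<close>
  is allowed because points are extended too.\<close>

lemma extended_line_eq:
  assumes "vec.subspace (W :: ('a ^ 'n) set)"
  shows "extended_line \<iota> W = {vec_of x y | x y. x \<in> W \<and> y \<in> W}"
proof -
  have "vec.subspace {vec_of x y | x y. x \<in> W \<and> y \<in> W}"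
  proof (rule vec.subspaceI)
    show "0 \<in> {vec_of x y | x y. x \<in> W \<and> y \<in> W}"
      using vec.subspace_0[OF assms] vec_of_0 by (metis (mono_tags, lifting) mem_Collect_eq)
    fix c v assume "v \<in> {vec_of x y | x y. x \<in> W \<and> y \<in> W}"
    then obtain x y where v: "v = vec_of x y" "x \<in> W" "y \<in> W" by blast
    obtain s t where c: "c = \<iota> s + \<omega> * \<iota> t" by (rule scalar_decomposition)
    show "c *s v \<in> {vec_of x y | x y. x \<in> W \<and> y \<in> W}"
      unfolding v(1) c vec_of_scale using v(2,3) assms
      by (auto simp: vec_of_eq_iff intro!: vec.subspace_add vec.subspace_scale)
  qed (use assms in \<open>auto simp: vec_of_add vec_of_eq_iff intro!: vec.subspace_add\<close>)
  moreover have "E ` W \<subseteq> {vec_of x y | x y. x \<in> W \<and> y \<in> W}"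
  proof clarify
    fix x assume "x \<in> W"
    moreover have "E x = vec_of x 0" by (simp add: vec_of_def E_simps)
    ultimately show "\<exists>u v. E x = vec_of u v \<and> u \<in> W \<and> v \<in> W"
      using vec.subspace_0[OF assms] by blast
  qed
  moreover have "vec_of x y \<in> vec.span (E ` W)" if "x \<in> W" "y \<in> W" for x y
    using that by (auto simp: vec_of_def intro!: vec.span_add vec.span_scale intro: vec.span_base)
  ultimately show ?thesis
    unfolding extended_line_def by (intro equalityI vec.span_minimal) auto
qed

lemma vec_of_in_extended_line_iff:
  assumes "vec.subspace (W :: ('a ^ 'n) set)"
  shows "vec_of x y \<in> extended_line \<iota> W \<longleftrightarrow> x \<in> W \<and> y \<in> W"
  by (auto simp: extended_line_eq[OF assms] vec_of_eq_iff)

lemma card_extended_line: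
  assumes "vec.subspace (W :: ('a ^ 'n) set)"
  shows "card (extended_line \<iota> W) = (card W)\<^sup>2"
proof -
  have "extended_line \<iota> W = (\<lambda>(x, y). vec_of x y) ` (W \<times> W)"
    by (auto simp: extended_line_eq[OF assms])
  moreover have "inj_on (\<lambda>(x, y). vec_of x y) (W \<times> W)"
    by (auto simp: inj_on_def vec_of_eq_iff)
  ultimately show ?thesis
    by (simp add: card_image card_cartesian_product power2_eq_square)
qed

lemma subspace_extended_line: "vec.subspace (extended_line \<iota> W)"
  by (simp add: extended_line_def)

lemma span_in_extended_line_iff:
  assumes "vec.subspace (W :: ('a ^ 'n) set)"
  shows "vec.span {vec_of x y} \<subseteq> extended_line \<iota> W \<longleftrightarrow> x \<in> W \<and> y \<in> W"
proof -
  have "vec.span {vec_of x y} \<subseteq> extended_line \<iota> W \<longleftrightarrow> vec_of x y \<in> extended_line \<iota> W"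
    using vec.span_minimal[OF _ subspace_extended_line] vec.span_base[of "vec_of x y" "{vec_of x y}"] by blast
  then show ?thesis by (simp add: vec_of_in_extended_line_iff[OF assms])
qed

lemma extended_point: "extended_line \<iota> (vec.span {x}) = vec.span {E x}"
proof
  have "E ` vec.span {x} \<subseteq> vec.span {E x}"
    by (auto simp: vec.span_singleton E_simps)
  then show "extended_line \<iota> (vec.span {x}) \<subseteq> vec.span {E x}"
    unfolding extended_line_def by (rule vec.span_minimal) simp
  show "vec.span {E x} \<subseteq> extended_line \<iota> (vec.span {x})"
    unfolding extended_line_def by (rule vec.span_mono) (auto intro: vec.span_base)
qed

lemma extended_line_inject:
  fixes W W' :: "('a ^ 'n) set"
  assumes "vec.subspace W" and "vec.subspace W'" and "extended_line \<iota> W = extended_line \<iota> W'"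
  shows "W = W'"
  using vec_of_in_extended_line_iff[OF assms(1)] vec_of_in_extended_line_iff[OF assms(2)] assms(3)
  by blast


section \<open>Counting points of the extended cover\<close>

lemma points_vec_of:
  assumes "P \<in> points"
  obtains x y where "vec_of x y \<noteq> 0" and "P = vec.span {vec_of x y}"
  using assms unfolding points_iff by (metis vec_of_decomposition)

text \<open>For a vector on the extension of a cover line both components are singular, so
  \<open>Q x = \<alpha> * Q y\<close> reads 0 = 0 and membership in the Hermitian variety is
  automatic.\<close>

lemma cover_extension_iff:
  assumes "line_cover Q m L"
  shows "P \<in> cover_extension CARD('a) \<iota> Q L \<longleftrightarrow> P \<in> points \<and> (\<exists>k\<in>L. P \<subseteq> extended_line \<iota> k)"
proof -
  have "P \<in> hermitian_points CARD('a) \<iota> Q"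
    if P: "P \<in> points" and k: "k \<in> L" "P \<subseteq> extended_line \<iota> k" for k
  proof -
    obtain x y where xy: "vec_of x y \<noteq> 0" "P = vec.span {vec_of x y}"
      using P by (rule points_vec_of)
    have "x \<in> k" "y \<in> k"
      using k(2) span_in_extended_line_iff[OF cover_lines(2)[OF assms k(1)]] by (auto simp: xy(2))
    then show ?thesis
      using xy cover_lines(3)[OF assms k(1)] by (simp add: hermitian_points_span)
  qed
  then show ?thesis
    by (auto simp: cover_extension_def hermitian_points_def)
qed

text \<open>If some \<open>x\<close> in \<open>k\<close> is not orthogonal to both \<open>u\<close>
  and \<open>v\<close>, then \<open>vec_of x 0\<close> shows that the perp cuts the extended line in
  a proper subspace, a single point. Otherwise all \<open>CARD('a)\<^sup>2 + 1\<close> points lie in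
  the perp.\<close>

lemma card_extended_line_perp_points:
  assumes k: "k \<in> lines"
  shows "card {R \<in> points. R \<subseteq> extended_line \<iota> k \<inter> {z. H z (vec_of u v) = 0}}
    = (if k \<subseteq> perp Q {u, v} then CARD('a)\<^sup>2 else 0) + 1"
proof -
  let ?W = "extended_line \<iota> k"
  let ?W' = "?W \<inter> {z. H z (vec_of u v) = 0}"
  have sub: "vec.subspace k" using k by (simp add: lines_def)
  have cardW: "card ?W = CARD('b)\<^sup>2"
    by (simp add: card_extended_line[OF sub] card_line[OF k] card_extension)
  have sub': "vec.subspace ?W'"
    using subspace_extended_line[of k] by (auto simp: vec.subspace_def EB_left)
  show ?thesis
  proof (cases "k \<subseteq> perp Q {u, v}")
    case True
    have "H (vec_of x y) (vec_of u v) = 0" if "x \<in> k" "y \<in> k" for x y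
    proof -
      have "B w u = 0" "B w v = 0" if "w \<in> k" for w
        using that True B_sym[of w] by (auto simp: perp_def)
      then show ?thesis using that by (simp add: EB_vec_of_eq_0_iff)
    qed
    then have "?W' = ?W" by (auto simp: extended_line_eq[OF sub])
    then show ?thesis
      using True card_points_subspace(2)[OF subspace_extended_line cardW] card_extension by simp
  next
    case False
    then obtain x where x: "x \<in> k" "\<not> (B x u = 0 \<and> B x v = 0)"
      using B_sym[of u] B_sym[of v] by (auto simp: perp_def)
    have "vec_of x 0 \<in> ?W"
      using x(1) vec.subspace_0[OF sub] by (simp add: vec_of_in_extended_line_iff[OF sub])
    moreover have "H (vec_of x 0) (vec_of u v) \<noteq> 0"
      using x(2) by (auto simp: EB_vec_of_eq_0_iff B_left)
    ultimately have "CARD('b) * card {z \<in> ?W. H z (vec_of u v) = 0} = card ?W"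
      by (rule card_kernel[OF subspace_extended_line EB_linear])
    then have "card ?W' = CARD('b)"
      by (simp add: cardW power2_eq_square Int_def)
    then show ?thesis
      using False card_points_subspace(1)[OF sub'] by simp
  qed
qed

text \<open>
  Double counting of the pairs of a line of the cover and a point of its extension in the perp:
  a point defined over the small field lies on \<open>m\<close> extended lines, any other point on one.
\<close>

lemma card_cover_extension_perp:
  assumes L: "line_cover Q m L"
  shows "card {R \<in> cover_extension CARD('a) \<iota> Q L. R \<subseteq> {z. H z (vec_of u v) = 0}}
      + m * card {P \<in> quadric_points Q. P \<subseteq> perp Q {u, v}}
    = card L + CARD('a)\<^sup>2 * card {k \<in> L. k \<subseteq> perp Q {u, v}}
      + card {P \<in> quadric_points Q. P \<subseteq> perp Q {u, v}}"
proof -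
  let ?Hp = "{z. H z (vec_of u v) = 0}"
  let ?N = "{P \<in> quadric_points Q. P \<subseteq> perp Q {u, v}}"
  let ?S = "{R \<in> cover_extension CARD('a) \<iota> Q L. R \<subseteq> ?Hp}"
  \<comment> \<open>\<open>?S\<close> holds the points to be counted and \<open>?T\<close> those
    among them that are defined over the small field.\<close>
  let ?T = "extended_line \<iota> ` ?N"
  note Lsub = cover_lines(2)[OF L] and Lsing = cover_lines(3)[OF L]
  have Hp_sub: "vec.subspace ?Hp" by (auto simp: vec.subspace_def EB_left)
  have E_vec: "E x = vec_of x 0" for x by (simp add: vec_of_def E_simps)
  have cardT: "card ?T = card ?N"
    by (rule card_image, rule inj_onI, rule extended_line_inject)
      (auto simp: quadric_points_def points_def)
  have mult: "card {k \<in> L. R \<subseteq> extended_line \<iota> k} = m" if R: "R \<in> ?T" for R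
  proof -
    obtain P where P: "P \<in> quadric_points Q" "R = extended_line \<iota> P" using R by blast
    then obtain x where x: "P = vec.span {x}" by (auto simp: quadric_points_def points_iff)
    have "R \<subseteq> extended_line \<iota> k \<longleftrightarrow> P \<subseteq> k" if "k \<in> L" for k
    proof -
      have "R \<subseteq> extended_line \<iota> k \<longleftrightarrow> x \<in> k"
        using vec.subspace_0[OF Lsub[OF that]]
        by (simp add: P(2) x extended_point E_vec span_in_extended_line_iff[OF Lsub[OF that]])
      also have "\<dots> \<longleftrightarrow> P \<subseteq> k"
        using vec.span_minimal[of "{x}" k] Lsub[OF that] vec.span_base[of x "{x}"] by (auto simp: x)
      finally show ?thesis .
    qed
    then have "{k \<in> L. R \<subseteq> extended_line \<iota> k} = {k \<in> L. P \<subseteq> k}" by blast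
    then show ?thesis using L P(1) by (simp add: line_cover_def)
  qed
  have TS: "?T \<subseteq> ?S"
  proof
    fix R assume R: "R \<in> ?T"
    then obtain P where P: "P \<in> quadric_points Q" "P \<subseteq> perp Q {u, v}" "R = extended_line \<iota> P" by blast
    then obtain x where x: "x \<noteq> 0" "P = vec.span {x}" by (auto simp: quadric_points_def points_iff)
    have Rx: "R = vec.span {vec_of x 0}" by (simp add: P(3) x(2) extended_point E_vec)
    \<comment> \<open>Here \<open>m > 0\<close> enters: some cover line passes through every point
      of the quadric.\<close>
    have "card {k \<in> L. R \<subseteq> extended_line \<iota> k} > 0"
      using mult[OF R] L by (simp add: line_cover_def)
    then obtain k where "k \<in> L" "R \<subseteq> extended_line \<iota> k" by (auto simp: card_gt_0_iff)
    moreover have "R \<in> points" using x(1) unfolding Rx points_iff by (metis vec_of_eq_0_iff)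
    moreover have "B x u = 0" "B x v = 0"
      using P(2) vec.span_base[of x "{x}"] B_sym[of x] by (auto simp: x(2) perp_def)
    then have "R \<subseteq> ?Hp"
      unfolding Rx by (intro vec.span_minimal Hp_sub) (simp add: EB_vec_of_eq_0_iff B_left)
    ultimately show "R \<in> ?S" using cover_extension_iff[OF L] by blast
  qed
  have single: "card {k \<in> L. R \<subseteq> extended_line \<iota> k} = 1" if R: "R \<in> ?S" "R \<notin> ?T" for R
  proof -
    have "R \<in> points" using R(1) cover_extension_iff[OF L] by blast
    then obtain x y where xy: "vec_of x y \<noteq> 0" "R = vec.span {vec_of x y}" by (rule points_vec_of)
    obtain k where k: "k \<in> L" "R \<subseteq> extended_line \<iota> k" using R(1) cover_extension_iff[OF L] by blast
    have in_iff: "R \<subseteq> extended_line \<iota> l \<longleftrightarrow> x \<in> l \<and> y \<in> l" if "l \<in> L" for l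
      unfolding xy(2) by (rule span_in_extended_line_iff[OF Lsub[OF that]])
    \<comment> \<open>A point generated by an extended small vector belongs to \<open>?T\<close>.
      Hence outside \<open>?T\<close> the components \<open>x\<close> and \<open>y\<close> must be
      independent.\<close>
    have rational: "R \<in> ?T" if eq: "vec_of x y = c *s E w" and w: "w \<in> k" for c w
    proof -
      have c0: "c \<noteq> 0" and w0: "w \<noteq> 0" using xy(1) eq by (auto simp: E_simps)
      have Rw: "R = vec.span {E w}"
        using vec.span_image_scale[of "{E w}" "\<lambda>_. c"] c0 by (simp add: xy(2) eq)
      have "E w \<in> ?Hp"
        using R(1) vec.span_base[of "E w" "{E w}"] unfolding Rw by blast
      then have "B w u = 0" "B w v = 0" by (auto simp: E_vec EB_vec_of_eq_0_iff B_left)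
      then have "vec.span {w} \<subseteq> perp Q {u, v}"
        by (intro vec.span_minimal perp_subspace) (simp add: perp_def B_sym[of _ w])
      moreover have "vec.span {w} \<in> quadric_points Q"
        using w0 Lsing[OF k(1) w] unfolding quadric_points_def points_iff
        by (auto simp: vec.span_singleton Q_scale)
      ultimately show ?thesis
        unfolding Rw extended_point[symmetric] by blast
    qed
    have x0: "x \<noteq> 0"
    proof
      assume "x = 0"
      then have "vec_of x y = \<omega> *s E y" by (simp add: vec_of_def E_simps)
      then show False using rational R(2) in_iff[OF k(1)] k(2) by blast
    qed
    have ind: "y \<noteq> c *s x" for c
    proof
      assume "y = c *s x"
      then have "vec_of x y = (1 + \<omega> * \<iota> c) *s E x"
        by (simp add: vec_of_def E_simps vector_sadd_rdistrib vector_smult_assoc)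
      then show False using rational R(2) in_iff[OF k(1)] k(2) by blast
    qed
    \<comment> \<open>Independent components determine any cover line whose extension contains
      \<open>R\<close>, which gives uniqueness.\<close>
    have "l = vec.span {x, y}" if "l \<in> L" "R \<subseteq> extended_line \<iota> l" for l
      using line_basis[OF cover_lines(1)[OF L that(1)] _ _ x0 ind] in_iff[OF that(1)] that(2) by blast
    then have "{l \<in> L. R \<subseteq> extended_line \<iota> l} = {k}" using k by blast
    then show ?thesis by simp
  qed
  have "(\<Sum>k\<in>L. card {R \<in> ?S. R \<subseteq> extended_line \<iota> k}) = (\<Sum>R\<in>?S. card {k \<in> L. R \<subseteq> extended_line \<iota> k})"
    by (rule sum_multicount_gen) auto
  moreover have "(\<Sum>R\<in>?S. card {k \<in> L. R \<subseteq> extended_line \<iota> k}) + card ?N = m * card ?N + card ?S"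
  proof -
    have "(\<Sum>R\<in>?S. card {k \<in> L. R \<subseteq> extended_line \<iota> k})
        = (\<Sum>R\<in>?S - ?T. card {k \<in> L. R \<subseteq> extended_line \<iota> k}) + (\<Sum>R\<in>?T. card {k \<in> L. R \<subseteq> extended_line \<iota> k})"
      by (rule sum.subset_diff[OF TS]) simp
    also have "\<dots> = (\<Sum>R\<in>?S - ?T. 1) + (\<Sum>R\<in>?T. m)"
      by (intro arg_cong2[where f="(+)"] sum.cong refl) (use single mult in blast)+
    also have "\<dots> = card (?S - ?T) + m * card ?N"
      unfolding sum_constant cardT by simp
    finally have e: "(\<Sum>R\<in>?S. card {k \<in> L. R \<subseteq> extended_line \<iota> k}) = card (?S - ?T) + m * card ?N" .
    have "card ?S = card ?T + card (?S - ?T)"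
      using card_Diff_subset[OF _ TS] card_mono[OF _ TS] by simp
    with e cardT show ?thesis by linarith
  qed
  moreover have "(\<Sum>k\<in>L. card {R \<in> ?S. R \<subseteq> extended_line \<iota> k})
      = CARD('a)\<^sup>2 * card {k \<in> L. k \<subseteq> perp Q {u, v}} + card L"
  proof -
    have "{R \<in> ?S. R \<subseteq> extended_line \<iota> k} = {R \<in> points. R \<subseteq> extended_line \<iota> k \<inter> ?Hp}" if "k \<in> L" for k
      using cover_extension_iff[OF L] that by blast
    then have "(\<Sum>k\<in>L. card {R \<in> ?S. R \<subseteq> extended_line \<iota> k})
        = (\<Sum>k\<in>L. (if k \<subseteq> perp Q {u, v} then CARD('a)\<^sup>2 else 0) + 1)"
      by (intro sum.cong refl) (simp only: card_extended_line_perp_points cover_lines(1)[OF L])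
    also have "\<dots> = (\<Sum>k\<in>L. if k \<subseteq> perp Q {u, v} then CARD('a)\<^sup>2 else 0) + (\<Sum>k\<in>L. 1)"
      by (rule sum.distrib)
    also have "(\<Sum>k\<in>L. if k \<subseteq> perp Q {u, v} then CARD('a)\<^sup>2 else 0) = card {k \<in> L. k \<subseteq> perp Q {u, v}} * CARD('a)\<^sup>2"
      by (simp flip: sum.inter_filter)
    finally show ?thesis by (simp only: card_eq_sum mult.commute)
  qed
  ultimately show ?thesis by linarith
qed

end

section \<open>Comparison of the two conditions\<close>

lemma real_theta:
  assumes "q \<ge> 2"
  shows "real (theta n q) = (real q ^ nat (n + 1) - 1) / (real q - 1)"
  using assms power_diff_1_eq[of "real q" "nat (n + 1)"] by (simp add: theta_def)

lemma real_geometric: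
  assumes "q \<ge> 2" and "N * (q - 1) = q ^ n - 1"
  shows "real N = (real q ^ n - 1) / (real q - 1)"
proof -
  have "real (N * (q - 1)) = real (q ^ n - 1)" unfolding assms(2) ..
  moreover have "1 \<le> q ^ n" using assms(1) by simp
  ultimately have "real N * (real q - 1) = real q ^ n - 1"
    using assms(1) by (simp add: of_nat_diff)
  then show ?thesis using assms(1) by (simp add: eq_divide_eq)
qed

lemma even_ge_4:
  fixes r :: nat
  assumes "even r" and "r \<ge> 4"
  obtains k where "r = 2 * k + 4"
  using assms by (metis dvdE dvd_add_right_iff even_numeral le_add_diff_inverse2 that add.commute)

lemma real_theta_half:
  assumes "q \<ge> 2" and "even r" and "r \<ge> 4"
  shows "real (theta ((int r - 4) div 2) (q\<^sup>2)) = (real q ^ (r - 2) - 1) / ((real q)\<^sup>2 - 1)"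
proof -
  obtain k where k: "r = 2 * k + 4" using assms(2,3) by (rule even_ge_4)
  have "2 * 1 \<le> q * q" using assms(1) by (intro mult_le_mono) auto
  then have "real (theta ((int r - 4) div 2) (q\<^sup>2)) = ((real q)\<^sup>2 ^ Suc k - 1) / ((real q)\<^sup>2 - 1)"
    using real_theta[of "q\<^sup>2" "(int r - 4) div 2"] by (simp add: k power2_eq_square nat_add_distrib)
  also have "(real q)\<^sup>2 ^ Suc k = real q ^ (r - 2)"
    unfolding power_mult[symmetric] by (simp add: k)
  finally show ?thesis .
qed

text \<open>The incidence equation makes \<open>c\<close> an affine function of \<open>A\<close>
  with slope \<open>q\<^sup>2\<close>, so prescribing one prescribes the other. The parameter
  \<open>e\<close> will be 1 or 0 for membership, and the slope carries the surplus
  \<open>q ^ (r - 4)\<close> to \<open>q ^ (r - 2)\<close>.\<close>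

lemma tight_count_generic:
  fixes q m r c l A N M e :: nat
  assumes q: "q \<ge> 2" and r: "even r" "r \<ge> 4"
    and N: "N * (q - 1) = q ^ (r - 2) - 1" and M: "M * (q - 1) = q ^ r - 1"
    and l: "(q + 1) * l = m * M" and c: "c + m * N = l + q\<^sup>2 * A + N"
  shows "c = (m * (q\<^sup>2 - q) + q + 1) * theta ((int r - 4) div 2) (q\<^sup>2) + e * q ^ (r - 2) \<longleftrightarrow>
    real A = real m * real (theta (int r - 5) q) / (real q + 1) + real e * real q ^ (r - 4)"
proof -
  obtain k where k: "r = 2 * k + 4" using r by (rule even_ge_4)
  define w x \<mu> where "w = real q ^ (2 * k)" and "x = real q" and "\<mu> = real m"
  have x1: "x - 1 \<noteq> 0" "x + 1 \<noteq> 0" "x \<noteq> 0" using q by (auto simp: x_def)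
  have x2: "x\<^sup>2 - 1 = (x - 1) * (x + 1)" by (simp add: power2_eq_square algebra_simps)
  have pw: "real q ^ (r - 2) = w * x\<^sup>2" "real q ^ (r - 4) = w" "real q ^ r = w * x ^ 4"
    by (simp_all add: k w_def x_def power_add power2_eq_square)
  have NM: "real N = (w * x\<^sup>2 - 1) / (x - 1)" "real M = (w * x ^ 4 - 1) / (x - 1)"
    using real_geometric[OF q N] real_geometric[OF q M] unfolding pw by (simp_all add: x_def)
  have "real ((q + 1) * l) = real (m * M)" unfolding l ..
  then have L: "real l = \<mu> * real M / (x + 1)" using x1 by (simp add: x_def \<mu>_def field_simps)
  have T: "real (theta ((int r - 4) div 2) (q\<^sup>2)) = (w * x\<^sup>2 - 1) / ((x - 1) * (x + 1))"
    unfolding real_theta_half[OF q r] pw x2[symmetric] by (simp add: x_def)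
  have "nat (int r - 5 + 1) = 2 * k" by (simp add: k)
  then have \<theta>: "real (theta (int r - 5) q) = (w - 1) / (x - 1)"
    using real_theta[OF q] by (simp add: x_def w_def)
  have i: "real (m * (q\<^sup>2 - q) + q + 1) = \<mu> * (x\<^sup>2 - x) + x + 1"
    by (simp add: of_nat_diff power2_eq_square x_def \<mu>_def)
  have "real (c + m * N) = real (l + q\<^sup>2 * A + N)" unfolding c ..
  then have C: "real c = real l + x\<^sup>2 * real A + real N - \<mu> * real N"
    by (simp add: x_def \<mu>_def)
  \<comment> \<open>The constant terms of the two conditions agree. What remains is the equation for
    \<open>A\<close> multiplied by \<open>x\<^sup>2\<close>, which is cancelled at the end.\<close>
  have key: "\<mu> * ((w * x ^ 4 - 1) / (x - 1)) / (x + 1) + (w * x\<^sup>2 - 1) / (x - 1) - \<mu> * ((w * x\<^sup>2 - 1) / (x - 1))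
      = (\<mu> * (x\<^sup>2 - x) + x + 1) * ((w * x\<^sup>2 - 1) / ((x - 1) * (x + 1))) - x\<^sup>2 * (\<mu> * ((w - 1) / (x - 1)) / (x + 1))"
    using x1 by (simp add: divide_simps) algebra
  have "c = (m * (q\<^sup>2 - q) + q + 1) * theta ((int r - 4) div 2) (q\<^sup>2) + e * q ^ (r - 2) \<longleftrightarrow>
      real c = real (m * (q\<^sup>2 - q) + q + 1) * real (theta ((int r - 4) div 2) (q\<^sup>2)) + real e * real q ^ (r - 2)"
    unfolding of_nat_eq_iff[where 'a = real, symmetric] by (simp only: of_nat_add of_nat_mult of_nat_power)
  also have "\<dots> \<longleftrightarrow> x\<^sup>2 * real A = x\<^sup>2 * (\<mu> * ((w - 1) / (x - 1)) / (x + 1) + real e * w)"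
  proof -
    have "x\<^sup>2 * (\<mu> * ((w - 1) / (x - 1)) / (x + 1) + real e * w)
        = x\<^sup>2 * (\<mu> * ((w - 1) / (x - 1)) / (x + 1)) + real e * (w * x\<^sup>2)"
      by (simp only: distrib_left mult_ac)
    with key show ?thesis
      unfolding C L NM T i pw by (intro iffI) linarith+
  qed
  also have "\<dots> \<longleftrightarrow> real A = real m * real (theta (int r - 5) q) / (real q + 1) + real e * real q ^ (r - 4)"
    unfolding \<theta> pw using x1(3) by (simp add: \<mu>_def x_def)
  finally show ?thesis .
qed

text \<open>Counting in the perp of a singular point fixes \<open>q * A\<close> as
  \<open>m * N - l\<close>. Substituting this for one factor in \<open>q\<^sup>2 * A\<close> leaves
  no unknown, and the condition becomes an identity.\<close>

lemma tight_count_rational: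
  fixes q m r c l A N M :: nat
  assumes q: "q \<ge> 2" and r: "even r" "r \<ge> 4"
    and N: "N * (q - 1) = q ^ (r - 1) - 1" and M: "M * (q - 1) = q ^ r - 1"
    and l: "(q + 1) * l = m * M" and A: "q * A + l = m * N" and c: "c + m * N = l + q\<^sup>2 * A + N"
  shows "c = (m * (q\<^sup>2 - q) + q + 1) * theta ((int r - 4) div 2) (q\<^sup>2) + q ^ (r - 2)"
proof -
  obtain k where k: "r = 2 * k + 4" using r by (rule even_ge_4)
  define w x \<mu> where "w = real q ^ (2 * k)" and "x = real q" and "\<mu> = real m"
  have x1: "x - 1 \<noteq> 0" "x + 1 \<noteq> 0" "x \<noteq> 0" using q by (auto simp: x_def)
  have x2: "x\<^sup>2 - 1 = (x - 1) * (x + 1)" by (simp add: power2_eq_square algebra_simps)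
  have "r - 1 = 2 * k + 3" using k by simp
  then have pw: "real q ^ (r - 2) = w * x\<^sup>2" "real q ^ (r - 1) = w * x ^ 3" "real q ^ r = w * x ^ 4"
    by (simp_all add: k w_def x_def power_add power2_eq_square)
  have NM: "real N = (w * x ^ 3 - 1) / (x - 1)" "real M = (w * x ^ 4 - 1) / (x - 1)"
    using real_geometric[OF q N] real_geometric[OF q M] unfolding pw by (simp_all add: x_def)
  have "real ((q + 1) * l) = real (m * M)" unfolding l ..
  then have L: "real l = \<mu> * real M / (x + 1)" using x1 by (simp add: x_def \<mu>_def field_simps)
  have T: "real (theta ((int r - 4) div 2) (q\<^sup>2)) = (w * x\<^sup>2 - 1) / ((x - 1) * (x + 1))"
    unfolding real_theta_half[OF q r] pw x2[symmetric] by (simp add: x_def)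
  have i: "real (m * (q\<^sup>2 - q) + q + 1) = \<mu> * (x\<^sup>2 - x) + x + 1"
    by (simp add: of_nat_diff power2_eq_square x_def \<mu>_def)
  have "real (q * A + l) = real (m * N)" unfolding A ..
  then have xA: "x * real A = \<mu> * real N - real l" by (simp add: x_def \<mu>_def)
  have "real (c + m * N) = real (l + q\<^sup>2 * A + N)" unfolding c ..
  then have C: "real c = real l + x * (\<mu> * real N - real l) + real N - \<mu> * real N"
    unfolding xA[symmetric] by (simp add: x_def \<mu>_def power2_eq_square)
  have "real c = (\<mu> * (x\<^sup>2 - x) + x + 1) * ((w * x\<^sup>2 - 1) / ((x - 1) * (x + 1))) + w * x\<^sup>2"
    unfolding C L NM using x1 by (simp add: divide_simps) algebra
  also have "\<dots> = real ((m * (q\<^sup>2 - q) + q + 1) * theta ((int r - 4) div 2) (q\<^sup>2) + q ^ (r - 2))"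
    unfolding of_nat_add[of "_ * _"] of_nat_mult i T of_nat_power pw by simp
  finally show ?thesis by (simp only: of_nat_eq_iff)
qed

section \<open>The tight set condition point by point\<close>

context hermitian_extension
begin

lemma rational_point_tight:
  assumes r: "CARD('n) = r + 1" "even r" "r \<ge> 4" and L: "line_cover Q m L"
    and x: "x \<noteq> 0" "Q x = 0"
  shows "card {R \<in> cover_extension CARD('a) \<iota> Q L. R \<subseteq> {z. H z (vec_of x 0) = 0}}
    = (m * ((CARD('a))\<^sup>2 - CARD('a)) + CARD('a) + 1) * theta ((int r - 4) div 2) ((CARD('a))\<^sup>2)
      + CARD('a) ^ (r - 2)"
proof -
  have p: "perp Q {x, 0} = perp Q {x}" by (auto simp: perp_def B_left)
  show ?thesis
    by (rule tight_count_rational[OF card_field_ge_2 r(2,3) card_quadric_points_perp_point[OF r(1,2) _ x]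
          card_quadric_points[OF r(1,2)] card_cover[OF L] card_cover_perp_point[OF L]
          card_cover_extension_perp[OF L, of x 0, unfolded p]])
      (use r(3) in simp)
qed

lemma irrational_point_tight_iff:
  assumes r: "CARD('n) = r + 1" "even r" "r \<ge> 4" and L: "line_cover Q m L"
    and l: "l \<in> lines" "radical l = {0} \<or> radical l = l" and uv: "l = vec.span {u, v}"
  shows "card {R \<in> cover_extension CARD('a) \<iota> Q L. R \<subseteq> {z. H z (vec_of u v) = 0}}
      = (m * ((CARD('a))\<^sup>2 - CARD('a)) + CARD('a) + 1) * theta ((int r - 4) div 2) ((CARD('a))\<^sup>2)
        + e * CARD('a) ^ (r - 2)
    \<longleftrightarrow> real (card {k \<in> L. k \<subseteq> perp Q l})
      = real m * real (theta (int r - 5) CARD('a)) / (real CARD('a) + 1) + real e * real CARD('a) ^ (r - 4)"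
proof -
  have p: "perp Q {u, v} = perp Q l" by (simp add: uv perp_span)
  show ?thesis
    by (rule tight_count_generic[OF card_field_ge_2 r(2,3) card_quadric_points_perp_line[OF r l]
          card_quadric_points[OF r(1,2)] card_cover[OF L]
          card_cover_extension_perp[OF L, of u v, unfolded p]])
qed

text \<open>A cover line whose extension contains the point must contain the independent vectors
  \<open>u\<close> and \<open>v\<close>, so it equals their span.\<close>

lemma irrational_point_in_cover_extension_iff:
  assumes L: "line_cover Q m L" and uv: "u \<noteq> 0" "\<And>c. v \<noteq> c *s u" "l = vec.span {u, v}"
  shows "vec.span {vec_of u v} \<in> cover_extension CARD('a) \<iota> Q L \<longleftrightarrow> l \<in> L"
proof -
  have "vec.span {vec_of u v} \<in> points"
    using uv(1) unfolding points_iff by (metis vec_of_eq_0_iff)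
  then have "vec.span {vec_of u v} \<in> cover_extension CARD('a) \<iota> Q L \<longleftrightarrow> (\<exists>k\<in>L. u \<in> k \<and> v \<in> k)"
    using span_in_extended_line_iff[OF cover_lines(2)[OF L]] by (auto simp: cover_extension_iff[OF L])
  also have "\<dots> \<longleftrightarrow> l \<in> L"
  proof
    assume "\<exists>k\<in>L. u \<in> k \<and> v \<in> k"
    then obtain k where k: "k \<in> L" "u \<in> k" "v \<in> k" by blast
    then have "k = l"
      using line_basis[OF cover_lines(1)[OF L k(1)] k(2,3) uv(1,2)] uv(3) by simp
    then show "l \<in> L" using k(1) by simp
  next
    assume "l \<in> L"
    then show "\<exists>k\<in>L. u \<in> k \<and> v \<in> k" using uv(3) by (auto intro!: bexI[of _ l] intro: vec.span_base)
  qed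
  finally show ?thesis .
qed

lemma tight_iff_dual:
  assumes r: "CARD('n) = r + 1" "even r" "r \<ge> 4" and L: "line_cover Q m L"
  shows "tight_set r CARD('a) \<iota> Q (m * ((CARD('a))\<^sup>2 - CARD('a)) + CARD('a) + 1)
      (cover_extension CARD('a) \<iota> Q L) \<longleftrightarrow> dual_cover_parabolic_I r CARD('a) Q m L"
    (is "tight_set r ?q \<iota> Q ?i ?X \<longleftrightarrow> _")
proof
  assume tight: "tight_set r ?q \<iota> Q ?i ?X"
  have main: "real (card {k \<in> L. k \<subseteq> perp Q l}) = real m * real (theta (int r - 5) ?q) / (real ?q + 1)
      + real (if l \<in> L then 1 else 0) * real ?q ^ (r - 4)"
    if l: "l \<in> lines" and good: "radical l = {0} \<or> radical l = l" for l
  proof -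
    \<comment> \<open>Every line of admissible type carries a Hermitian point with independent
      components; the tight condition at this one point yields the count for
      \<open>l\<close>.\<close>
    obtain u v where uv: "u \<noteq> 0" "\<And>c. v \<noteq> c *s u" "l = vec.span {u, v}" "Q u = \<alpha> * Q v"
      using good nonsquare_basis_iff[OF l nonsquare] by blast
    let ?P = "vec.span {vec_of u v}"
    have "?P \<in> hermitian_points ?q \<iota> Q"
      using uv by (simp add: hermitian_points_span vec_of_eq_0_iff)
    then have "card {R \<in> ?X. R \<subseteq> hermitian_perp ?q \<iota> Q ?P} =
        ?i * theta ((int r - 4) div 2) (?q\<^sup>2) + (if ?P \<in> ?X then ?q ^ (r - 2) else 0)"
      using tight by (simp add: tight_set_def)
    also have "(if ?P \<in> ?X then ?q ^ (r - 2) else 0) = (if l \<in> L then 1 else 0) * ?q ^ (r - 2)"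
      by (simp add: irrational_point_in_cover_extension_iff[OF L uv(1-3)])
    finally show ?thesis
      unfolding hermitian_perp_span irrational_point_tight_iff[OF r L l good uv(3)] .
  qed
  have total: "radical l = l" if "l \<in> L" for l
    using totally_singular_iff cover_lines(2,3)[OF L that] by blast
  show "dual_cover_parabolic_I r ?q Q m L"
    unfolding dual_cover_parabolic_I_def
  proof (intro conjI ballI impI L)
    fix l :: "('a ^ 'n) set" assume l: "l \<in> lines" and "l \<in> L"
    then show "real (card {k \<in> L. k \<subseteq> perp Q l}) =
        real m * real (theta (int r - 5) ?q) / (real ?q + 1) + real ?q ^ (r - 4)"
      using main[OF l] total by simp
  next
    fix l :: "('a ^ 'n) set" assume l: "l \<in> lines"
      and "l \<notin> L \<and> card {P \<in> quadric_points Q. P \<subseteq> l} \<in> {0, 2, ?q + 1}"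
    then show "real (card {k \<in> L. k \<subseteq> perp Q l}) = real m * real (theta (int r - 5) ?q) / (real ?q + 1)"
      using main[OF l] card_quadric_points_on_line_iff[OF l] by simp
  qed
next
  assume dual: "dual_cover_parabolic_I r ?q Q m L"
  show "tight_set r ?q \<iota> Q ?i ?X"
    unfolding tight_set_def
  proof (intro conjI ballI)
    show "?X \<subseteq> hermitian_points ?q \<iota> Q" by (auto simp: cover_extension_def)
    fix P assume P: "P \<in> hermitian_points ?q \<iota> Q"
    then have "P \<in> points" by (simp add: hermitian_points_def)
    then obtain u v where Puv: "vec_of u v \<noteq> 0" "P = vec.span {vec_of u v}" by (rule points_vec_of)
    show "card {R \<in> ?X. R \<subseteq> hermitian_perp ?q \<iota> Q P} =
        ?i * theta ((int r - 4) div 2) (?q\<^sup>2) + (if P \<in> ?X then ?q ^ (r - 2) else 0)"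
    \<comment> \<open>The distinction is whether \<open>P\<close> is defined over the small field,
      that is, whether some generator has second component 0.\<close>
    proof (cases "\<exists>x c. vec_of u v = c *s vec_of x 0")
      case True
      then obtain x c where xc: "vec_of u v = c *s vec_of x 0" by blast
      then have c: "c \<noteq> 0" and x: "x \<noteq> 0" using Puv(1) by (auto simp: vec_of_eq_0_iff)
      have Px: "P = vec.span {vec_of x 0}"
        using vec.span_image_scale[of "{vec_of x 0}" "\<lambda>_. c"] c by (simp add: Puv(2) xc)
      then have Qx: "Q x = 0" using P by (simp add: hermitian_points_span)
      have sing: "vec.span {x} \<in> quadric_points Q"
        using x Qx unfolding quadric_points_def points_iff by (auto simp: vec.span_singleton Q_scale)
      \<comment> \<open>As \<open>m > 0\<close>, a cover line passes through the point, so
        \<open>P\<close> belongs to \<open>?X\<close> and the surplus term is the one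
        required.\<close>
      have "card {k \<in> L. vec.span {x} \<subseteq> k} > 0" using L sing by (simp add: line_cover_def)
      then obtain k where k: "k \<in> L" "vec.span {x} \<subseteq> k" by (auto simp: card_gt_0_iff)
      have "P \<subseteq> extended_line \<iota> k"
        using k(2) vec.span_base[of x "{x}"] vec.subspace_0[OF cover_lines(2)[OF L k(1)]]
        by (auto simp: Px span_in_extended_line_iff[OF cover_lines(2)[OF L k(1)]])
      then have "P \<in> ?X" using k(1) \<open>P \<in> points\<close> cover_extension_iff[OF L] by blast
      then show ?thesis
        unfolding Px hermitian_perp_span using rational_point_tight[OF r L x Qx] by simp
    next
      case False
      have u0: "u \<noteq> 0"
      proof
        assume "u = 0"
        then have "vec_of u v = \<omega> *s vec_of v 0" by (simp add: vec_of_def E_simps)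
        then show False using False by blast
      qed
      have ind: "v \<noteq> c *s u" for c
      proof
        assume "v = c *s u"
        then have "vec_of u v = (1 + \<omega> * \<iota> c) *s vec_of u 0"
          by (simp add: vec_of_def E_simps vector_sadd_rdistrib vector_smult_assoc)
        then show False using False by blast
      qed
      define l where "l = vec.span {u, v}"
      have l: "l \<in> lines" unfolding lines_iff l_def using u0 ind by blast
      \<comment> \<open>The Hermitian equation excludes tangent lines, so the dual cover condition
        does apply to \<open>l\<close>.\<close>
      have "Q u = \<alpha> * Q v" using P by (simp add: Puv(2) hermitian_points_span)
      then have good: "radical l = {0} \<or> radical l = l"
        using nonsquare_basis_iff[OF l nonsquare] u0 ind l_def by blast
      have in_iff: "P \<in> ?X \<longleftrightarrow> l \<in> L"
        unfolding Puv(2) by (rule irrational_point_in_cover_extension_iff[OF L u0 ind l_def])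
      have "real (card {k \<in> L. k \<subseteq> perp Q l}) = real m * real (theta (int r - 5) ?q) / (real ?q + 1)
          + real (if l \<in> L then 1 else 0) * real ?q ^ (r - 4)"
        using dual l good card_quadric_points_on_line_iff[OF l] by (simp add: dual_cover_parabolic_I_def)
      then have "card {R \<in> ?X. R \<subseteq> {z. H z (vec_of u v) = 0}}
          = ?i * theta ((int r - 4) div 2) (?q\<^sup>2) + (if l \<in> L then 1 else 0) * ?q ^ (r - 2)"
        unfolding irrational_point_tight_iff[OF r L l good l_def] .
      then show ?thesis
        unfolding in_iff by (simp add: Puv(2) hermitian_perp_span)
    qed
  qed
qed

end

theorem theorem4p9:
  fixes Q :: "'a::{field,finite} ^ 'n::finite \<Rightarrow> 'a"
    and \<iota> :: "'a \<Rightarrow> 'b::{field,finite}"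
    and L :: "('a ^ 'n) set set"
    and r q m :: nat
  assumes "4 \<le> r" and "even r"
    and "primepow q" and "odd q"
    and "CARD('a) = q" and "CARD('b) = q\<^sup>2" and "CARD('n) = r + 1"
    and "field_embedding \<iota>"
    and "nondegenerate_quadratic_form Q"
    and "line_cover Q m L"
  shows "tight_set r q \<iota> Q (m * (q\<^sup>2 - q) + q + 1) (cover_extension q \<iota> Q L)
     \<longleftrightarrow> dual_cover_parabolic_I r q Q m L"
proof -
  note q = assms(5)[symmetric]
  obtain \<omega> \<alpha> where \<omega>: "\<omega> ^ CARD('a) = - \<omega>" "\<omega>\<^sup>2 = \<iota> \<alpha>" "\<And>c. c\<^sup>2 \<noteq> \<alpha>"
    by (rule nonsquare_root_exists[OF assms(3,4,6)[unfolded q] assms(8)]) blast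
  \<comment> \<open>The conclusion does not mention \<omega> or \<alpha>, so any choice with these
    properties serves.\<close>
  interpret hermitian_extension Q \<iota> \<omega> \<alpha>
    by unfold_locales (use \<omega> assms(3,4,6,8,9) in \<open>simp_all add: assms(5)\<close>)
  show ?thesis
    unfolding q by (rule tight_iff_dual[OF assms(7,2,1,10)])
qed

end
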